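(* Any bi-invariant square integrable random field $X=X^\ell=\sum_{m,s=-\ell}^{\ell}a^\ell_{m,s}\phi^\ell_{m,s}$ on $SU(2)\cong S^3$ of degree $2\ell\in\mathbb{N}$ is a superposition $X=\sum_{s=-\ell}^{\ell}X^\ell_{\bullet,s}$, with $X^\ell_{\bullet,s}=\sum_{m=-\ell}^{\ell}a^\ell_{m,s}\phi^\ell_{m,s}$, of random spin weighted functions of every spin weight $s\in\{-\ell,-\ell+1,\dots,\ell\}$, such that two of them can be correlated only when they have opposite spin. Moreover, each spin weight appears with the same magnitude, meaning that the probability $\mathbb{E}RS[X]$ has to be uniform on $\{-\ell,-\ell+1,\dots,\ell\}$.
   Context: $m,s\in\{-\ell,-\ell+1,\dots,\ell\}$. Elements of $SU(2)$ are $h(\alpha,\beta)=\begin{pmatrix}\alpha&-\overline\beta\\ \beta&\overline\alpha\end{pmatrix}$, $|\alpha|^2+|\beta|^2=1$; $SU(2)\cong S^3$ carries the round metric of radius 2 (volume $16\pi^2$). Wigner functions: with $\psi^\ell_m(z_0,z_1)=\binom{2\ell}{\ell+m}^{1/2}z_0^{\ell+m}z_1^{\ell-m}$, $D^\ell_{m,s}:SU(2)\to\mathbb{C}$ is defined by $\sum_m\psi^\ell_m(z_0,z_1)D^\ell_{m,s}(h(\alpha,\beta))=\psi^\ell_s(\overline\alpha z_0+\overline\beta z_1,-\beta z_0+\alpha z_1)$ for all $z_0,z_1\in\mathbb{C}$. The functions $\phi^\ell_{m,s}=\frac{\sqrt{2\ell+1}}{4\pi}D^\ell_{m,s}$ form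 an orthonormal basis of $L^2(SU(2))$. A random spin weighted function of spin weight $s$ is (via pull-back of sections of the spin $s$ line bundle on $S^2$) a random function $F:SU(2)\to\mathbb{C}$ with $F(g\,g_3(\psi))=F(g)e^{-is\psi}$ for all $\psi\in\mathbb{R}$, almost surely, where $g_3(\psi)=\mathrm{diag}(e^{i\psi/2},e^{-i\psi/2})$. A random field is a measurable $X:\Omega\times SU(2)\to\mathbb{C}$, with $\Omega$ a probability space; it is square integrable if $X(\omega,\cdot)\in L^2(SU(2))$ almost surely. $X$ is bi-invariant if $X(g^{-1}\cdot g')$ has the same law as $X$ for all $g,g'\in SU(2)$ (equivalently, invariance in law under $SO(4)$). Two fields $Y,Z$ are uncorrelated if for all $g,g'$, $\mathbb{E}\{Y(g)Z(g')\}=\mathbb{E}Y(g)\mathbb{E}Z(g')$ and $\mathbb{E}\{Y(g)\overline{Z(g')}\}=\mathbb{E}Y(g)\overline{\mathbb{E}Z(g')}$; otherwise correlated. "Two of them" refers to two different components of the superposition. For $X=X^\ell$, $\mathbb{E}RS[X]$ is the probability given by $\mathbb{E}RS[X](\{s\})=\mathbb{E}\left\{\|X^\ell_{\bullet,s}\|^2/\|X\|^2\right\}$, with $L^2(SU(2))$ norms. *)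

theory Defs
  imports "HOL-Probability.Probability"
begin

definition su2_mat :: "complex \<Rightarrow> complex \<Rightarrow> complex^2^2" where
  "su2_mat \<alpha> \<beta> = vector [vector [\<alpha>, - cnj \<beta>], vector [\<beta>, cnj \<alpha>]]"

definition SU2 :: "(complex^2^2) set" where
  "SU2 = {su2_mat \<alpha> \<beta> | \<alpha> \<beta>. (cmod \<alpha>)\<^sup>2 + (cmod \<beta>)\<^sup>2 = 1}"

definition g3 :: "real \<Rightarrow> complex^2^2" where
  "g3 \<psi> = vector [vector [cis (\<psi> / 2), 0], vector [0, cis (- \<psi> / 2)]]"

abbreviation su2_borel :: "(complex^2^2) measure" where
  "su2_borel \<equiv> restrict_space borel SU2"

(* Riemannian volume of the round 3-sphere of radius 2.  The surface measure of a set A on the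
   sphere of radius r in R^4 = C^2 is 4 / r times the Lebesgue measure of the cone
   {t x | 0 < t <= 1, x in A}; here r = 2, and the point (alpha, beta) of the unit sphere
   (equivalently 2 (alpha, beta) of the sphere of radius 2) is identified with
   su2_mat alpha beta.  The total mass is 16 pi^2, see emeasure_su2_volume below. *)
definition su2_volume :: "(complex^2^2) measure" where
  "su2_volume = scale_measure 2
     (distr (restrict_space lborel {z :: complex \<times> complex. 0 < norm z \<and> norm z \<le> 2}) su2_borel
        (\<lambda>z. su2_mat (fst z / of_real (norm z)) (snd z / of_real (norm z))))"

definition L2_norm_SU2 :: "(complex^2^2 \<Rightarrow> complex) \<Rightarrow> real" where
  "L2_norm_SU2 f = sqrt (LINT g|su2_volume. (cmod (f g))\<^sup>2)"

(* {-l, -l + 1, ..., l} for a half-integer l. *)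
definition weights :: "real \<Rightarrow> real set" where
  "weights l = {- l + real k | k. - l + real k \<le> l}"

(* For m in weights l with 2 l a natural number, l + m, l - m and 2 l are natural numbers,
   so the floors are exact. *)
definition psi :: "real \<Rightarrow> real \<Rightarrow> complex \<Rightarrow> complex \<Rightarrow> complex" where
  "psi l m z0 z1 =
     of_real (sqrt (real (nat \<lfloor>2 * l\<rfloor> choose nat \<lfloor>l + m\<rfloor>)))
       * z0 ^ nat \<lfloor>l + m\<rfloor> * z1 ^ nat \<lfloor>l - m\<rfloor>"

definition wigner_identity ::
  "real \<Rightarrow> real \<Rightarrow> complex \<Rightarrow> complex \<Rightarrow> (real \<Rightarrow> complex) \<Rightarrow> bool" where
  "wigner_identity l s \<alpha> \<beta> D \<longleftrightarrow>
     (\<forall>z0 z1. (\<Sum>m\<in>weights l. psi l m z0 z1 * D m)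
            = psi l s (cnj \<alpha> * z0 + cnj \<beta> * z1) (- \<beta> * z0 + \<alpha> * z1))"

(* alpha and beta are read off the first column of the matrix.  The description is proper for
   2 l a natural number and m, s in weights l, see wignerD_identity and wignerD_eqI below. *)
definition wignerD :: "real \<Rightarrow> real \<Rightarrow> real \<Rightarrow> complex^2^2 \<Rightarrow> complex" where
  "wignerD l m s g = (THE d. \<exists>D. wigner_identity l s (g $ 1 $ 1) (g $ 2 $ 1) D \<and> D m = d)"

definition phi :: "real \<Rightarrow> real \<Rightarrow> real \<Rightarrow> complex^2^2 \<Rightarrow> complex" where
  "phi l m s g = of_real (sqrt (2 * l + 1) / (4 * pi)) * wignerD l m s g"

definition random_field :: "'w measure \<Rightarrow> ('w \<Rightarrow> complex^2^2 \<Rightarrow> complex) \<Rightarrow> bool" where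
  "random_field M X \<longleftrightarrow> (\<lambda>(\<omega>, g). X \<omega> g) \<in> borel_measurable (M \<Otimes>\<^sub>M su2_borel)"

definition square_integrable_field :: "'w measure \<Rightarrow> ('w \<Rightarrow> complex^2^2 \<Rightarrow> complex) \<Rightarrow> bool" where
  "square_integrable_field M X \<longleftrightarrow>
     (AE \<omega> in M. integrable su2_volume (\<lambda>g. (cmod (X \<omega> g))\<^sup>2))"

definition field_law ::
  "'w measure \<Rightarrow> ('w \<Rightarrow> complex^2^2 \<Rightarrow> complex) \<Rightarrow> (complex^2^2 \<Rightarrow> complex) measure" where
  "field_law M X = distr M (\<Pi>\<^sub>M g\<in>SU2. borel) (\<lambda>\<omega>. \<lambda>g\<in>SU2. X \<omega> g)"

definition bi_invariant :: "'w measure \<Rightarrow> ('w \<Rightarrow> complex^2^2 \<Rightarrow> complex) \<Rightarrow> bool" where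
  "bi_invariant M X \<longleftrightarrow>
     (\<forall>g\<in>SU2. \<forall>g'\<in>SU2. field_law M (\<lambda>\<omega> x. X \<omega> (matrix_inv g ** x ** g')) = field_law M X)"

definition random_spin_weighted ::
  "'w measure \<Rightarrow> real \<Rightarrow> ('w \<Rightarrow> complex^2^2 \<Rightarrow> complex) \<Rightarrow> bool" where
  "random_spin_weighted M s F \<longleftrightarrow> random_field M F \<and>
     (AE \<omega> in M. \<forall>g\<in>SU2. \<forall>\<psi>. F \<omega> (g ** g3 \<psi>) = F \<omega> g * cis (- s * \<psi>))"

definition uncorrelated ::
  "'w measure \<Rightarrow> ('w \<Rightarrow> complex^2^2 \<Rightarrow> complex) \<Rightarrow> ('w \<Rightarrow> complex^2^2 \<Rightarrow> complex) \<Rightarrow> bool" where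
  "uncorrelated M Y Z \<longleftrightarrow> (\<forall>g\<in>SU2. \<forall>g'\<in>SU2.
     (LINT \<omega>|M. Y \<omega> g * Z \<omega> g') = (LINT \<omega>|M. Y \<omega> g) * (LINT \<omega>|M. Z \<omega> g') \<and>
     (LINT \<omega>|M. Y \<omega> g * cnj (Z \<omega> g')) = (LINT \<omega>|M. Y \<omega> g) * cnj (LINT \<omega>|M. Z \<omega> g'))"

abbreviation correlated ::
  "'w measure \<Rightarrow> ('w \<Rightarrow> complex^2^2 \<Rightarrow> complex) \<Rightarrow> ('w \<Rightarrow> complex^2^2 \<Rightarrow> complex) \<Rightarrow> bool" where
  "correlated M Y Z \<equiv> \<not> uncorrelated M Y Z"

definition spin_component ::
  "real \<Rightarrow> (real \<Rightarrow> real \<Rightarrow> 'w \<Rightarrow> complex) \<Rightarrow> real \<Rightarrow> 'w \<Rightarrow> complex^2^2 \<Rightarrow> complex" where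
  "spin_component l a s \<omega> g = (\<Sum>m\<in>weights l. a m s \<omega> * phi l m s g)"

(* The masses add up to 1 exactly when X is almost surely not the zero field. *)
definition expected_RS ::
  "'w measure \<Rightarrow> real \<Rightarrow> (real \<Rightarrow> real \<Rightarrow> 'w \<Rightarrow> complex) \<Rightarrow> ('w \<Rightarrow> complex^2^2 \<Rightarrow> complex) \<Rightarrow> real measure" where
  "expected_RS M l a X = point_measure (weights l)
     (\<lambda>s. ennreal (LINT \<omega>|M. (L2_norm_SU2 (spin_component l a s \<omega>))\<^sup>2 / (L2_norm_SU2 (X \<omega>))\<^sup>2))"

lemma weights_eq:
  assumes "2 * l \<in> \<nat>"
  shows "weights l = (\<lambda>k. - l + real k) ` {..nat \<lfloor>2 * l\<rfloor>}"
proof -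
  obtain n where n: "2 * l = real n" using assms by (auto elim: Nats_cases)
  then have "nat \<lfloor>2 * l\<rfloor> = n" by simp
  moreover have "- l + real k \<le> l \<longleftrightarrow> k \<le> n" for k using n by linarith
  ultimately show ?thesis by (auto simp: weights_def)
qed

lemma sum_psi_weights:
  assumes "2 * l \<in> \<nat>" and n: "n = nat \<lfloor>2 * l\<rfloor>"
  shows "(\<Sum>m\<in>weights l. psi l m z0 z1 * D m)
    = (\<Sum>k\<le>n. (of_real (sqrt (real (n choose k))) * D (- l + real k)) * z0 ^ k * z1 ^ (n - k))"
proof -
  have l: "2 * l = real n" using assms by (auto elim: Nats_cases)
  have "(\<Sum>m\<in>weights l. psi l m z0 z1 * D m)
      = (\<Sum>k\<le>n. psi l (- l + real k) z0 z1 * D (- l + real k))"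
    unfolding weights_eq[OF assms(1)] n[symmetric]
    by (subst sum.reindex) (auto simp: inj_on_def)
  also have "\<dots> = (\<Sum>k\<le>n. (of_real (sqrt (real (n choose k))) * D (- l + real k)) * z0 ^ k * z1 ^ (n - k))"
  proof (rule sum.cong[OF refl])
    fix k assume "k \<in> {..n}"
    then have "l - (- l + real k) = real (n - k)" "l + (- l + real k) = real k" using l by auto
    then show "psi l (- l + real k) z0 z1 * D (- l + real k)
        = (of_real (sqrt (real (n choose k))) * D (- l + real k)) * z0 ^ k * z1 ^ (n - k)"
      unfolding psi_def by (simp only: floor_of_nat nat_int n) (simp add: algebra_simps)
  qed
  finally show ?thesis .
qed

lemma homogeneous_mult_linear:
  fixes f :: "complex \<Rightarrow> complex \<Rightarrow> complex"
  assumes "\<exists>e. \<forall>x y. f x y = (\<Sum>k\<le>N. e k * x ^ k * y ^ (N - k))"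
  shows "\<exists>e. \<forall>x y. (A * x + B * y) * f x y = (\<Sum>k\<le>Suc N. e k * x ^ k * y ^ (Suc N - k))"
proof -
  obtain e where e: "\<And>x y. f x y = (\<Sum>k\<le>N. e k * x ^ k * y ^ (N - k))" using assms by blast
  define e' where
    "e' k = (if k = 0 then 0 else A * e (k - 1)) + (if k \<le> N then B * e k else 0)" for k
  have "(A * x + B * y) * f x y = (\<Sum>k\<le>Suc N. e' k * x ^ k * y ^ (Suc N - k))" for x y
  proof -
    have 1: "(\<Sum>k\<le>Suc N. (if k = 0 then 0 else A * e (k - 1)) * x ^ k * y ^ (Suc N - k))
        = A * x * f x y"
      by (subst sum.atMost_Suc_shift)
         (simp add: e sum_distrib_left algebra_simps del: sum.atMost_Suc)
    have "(\<Sum>k\<le>Suc N. (if k \<le> N then B * e k else 0) * x ^ k * y ^ (Suc N - k))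
        = (\<Sum>k\<le>N. B * e k * x ^ k * y ^ (Suc N - k))" by simp
    also have "\<dots> = B * y * f x y"
      by (simp add: e sum_distrib_left algebra_simps Suc_diff_le)
    finally have 2: "(\<Sum>k\<le>Suc N. (if k \<le> N then B * e k else 0) * x ^ k * y ^ (Suc N - k))
        = B * y * f x y" .
    show ?thesis
      unfolding e'_def distrib_right sum.distrib using 1 2 by simp
  qed
  then show ?thesis by blast
qed

lemma homogeneous_power_product:
  fixes A B C E :: complex
  shows "\<exists>e. \<forall>x y. (A * x + B * y) ^ p * (C * x + E * y) ^ q
    = (\<Sum>k\<le>p + q. e k * x ^ k * y ^ (p + q - k))"
proof (induction p)
  case 0
  show ?case
  proof (induction q)
    case 0
    show ?case by (rule exI[of _ "\<lambda>_. 1"]) simp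
  next
    case (Suc q)
    from homogeneous_mult_linear[OF this, of C E] show ?case by (simp add: mult.assoc)
  qed
next
  case (Suc p)
  from homogeneous_mult_linear[OF this, of A B] show ?case by (simp add: mult.assoc)
qed

lemma wigner_identity_unique:
  assumes l: "2 * l \<in> \<nat>" and m: "m \<in> weights l"
    and "wigner_identity l s \<alpha> \<beta> D" and "wigner_identity l s \<alpha> \<beta> D'"
  shows "D m = D' m"
proof -
  define n where "n = nat \<lfloor>2 * l\<rfloor>"
  obtain k where k: "m = - l + real k" "k \<le> n"
    using m unfolding weights_eq[OF l] n_def by auto
  define c where "c i E = complex_of_real (sqrt (real (n choose i))) * E (- l + real i)" for i E
  have "(\<Sum>i\<le>n. c i D * z ^ i) = (\<Sum>i\<le>n. c i D' * z ^ i)" for z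
    using assms(3,4)[unfolded wigner_identity_def sum_psi_weights[OF l n_def], rule_format, of z 1]
    by (simp add: c_def)
  then have "c k D = c k D'" using k(2) by (metis polyfun_eq_coeffs)
  then show ?thesis using k by (simp add: c_def)
qed

lemma wigner_identity_exists:
  assumes l: "2 * l \<in> \<nat>" and s: "s \<in> weights l"
  shows "\<exists>D. wigner_identity l s \<alpha> \<beta> D"
proof -
  define n where "n = nat \<lfloor>2 * l\<rfloor>"
  have ln: "2 * l = real n" using l by (auto elim: Nats_cases simp: n_def)
  obtain j where j: "s = - l + real j" "j \<le> n"
    using s unfolding weights_eq[OF l] n_def by auto
  have "l - s = real (n - j)" "l + s = real j" using ln j by auto
  then have p: "nat \<lfloor>l + s\<rfloor> = j" and q: "nat \<lfloor>l - s\<rfloor> = n - j" by simp_all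
  obtain e where e: "\<And>x y. (cnj \<alpha> * x + cnj \<beta> * y) ^ j * (- \<beta> * x + \<alpha> * y) ^ (n - j)
      = (\<Sum>k\<le>n. e k * x ^ k * y ^ (n - k))"
    using homogeneous_power_product[of "cnj \<alpha>" "cnj \<beta>" j "- \<beta>" \<alpha> "n - j"] j(2) by auto
  define r where "r i = complex_of_real (sqrt (real (n choose i)))" for i
  define D where "D m = r j * e (nat \<lfloor>l + m\<rfloor>) / r (nat \<lfloor>l + m\<rfloor>)" for m
  have "wigner_identity l s \<alpha> \<beta> D"
    unfolding wigner_identity_def
  proof (intro allI)
    fix z0 z1
    have "(\<Sum>m\<in>weights l. psi l m z0 z1 * D m) = (\<Sum>k\<le>n. r j * (e k * z0 ^ k * z1 ^ (n - k)))"
      unfolding sum_psi_weights[OF l n_def]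
      by (rule sum.cong) (auto simp: D_def r_def)
    also have "\<dots> = psi l s (cnj \<alpha> * z0 + cnj \<beta> * z1) (- \<beta> * z0 + \<alpha> * z1)"
      unfolding sum_distrib_left[symmetric] e[symmetric] psi_def p q n_def[symmetric] r_def
      by (simp add: mult.assoc)
    finally show "(\<Sum>m\<in>weights l. psi l m z0 z1 * D m)
        = psi l s (cnj \<alpha> * z0 + cnj \<beta> * z1) (- \<beta> * z0 + \<alpha> * z1)" .
  qed
  then show ?thesis by blast
qed

lemma wignerD_eqI:
  assumes "2 * l \<in> \<nat>" "m \<in> weights l" "wigner_identity l s \<alpha> \<beta> D"
  shows "wignerD l m s (su2_mat \<alpha> \<beta>) = D m"
  unfolding wignerD_def su2_mat_def
  using assms by (auto intro!: the_equality dest: wigner_identity_unique)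

theorem wignerD_identity:
  assumes "2 * l \<in> \<nat>" "s \<in> weights l"
  shows "wigner_identity l s \<alpha> \<beta> (\<lambda>m. wignerD l m s (su2_mat \<alpha> \<beta>))"
proof -
  obtain D where D: "wigner_identity l s \<alpha> \<beta> D" using wigner_identity_exists[OF assms] by blast
  then show ?thesis
    unfolding wigner_identity_def by (simp add: wignerD_eqI[OF assms(1) _ D])
qed

lemma continuous_on_su2_mat:
  assumes "continuous_on A f" "continuous_on A g"
  shows "continuous_on A (\<lambda>x. su2_mat (f x) (g x))"
proof -
  have "su2_mat (f x) (g x) = (\<chi> i j. if i = 1 then (if j = 1 then f x else - cnj (g x))
      else (if j = 1 then g x else cnj (f x)))" for x
    by (simp add: su2_mat_def vec_eq_iff forall_2)
  moreover have "continuous_on A (\<lambda>x. (\<chi> i j. if i = 1 then (if j = 1 then f x else - cnj (g x))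
      else (if j = 1 then g x else cnj (f x))) :: complex^2^2)"
  proof (intro continuous_on_vec_lambda)
    fix i j :: 2
    show "continuous_on A (\<lambda>x. if i = 1 then (if j = 1 then f x else - cnj (g x))
        else (if j = 1 then g x else cnj (f x)))"
      by (cases "i = 1"; cases "j = 1") (auto intro!: continuous_intros assms)
  qed
  ultimately show ?thesis by simp
qed

lemma measurable_su2_projection:
  "(\<lambda>z. su2_mat (fst z / of_real (norm z)) (snd z / of_real (norm z)))
     \<in> measurable (restrict_space lborel {z :: complex \<times> complex. 0 < norm z \<and> norm z \<le> 2}) su2_borel"
  (is "?f \<in> measurable (restrict_space lborel ?A) _")
proof (rule measurable_restrict_space2)
  have "(cmod (fst z / of_real (norm z)))\<^sup>2 + (cmod (snd z / of_real (norm z)))\<^sup>2 = 1"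
    if "z \<noteq> 0" for z :: "complex \<times> complex"
  proof -
    have "(norm z)\<^sup>2 = (cmod (fst z))\<^sup>2 + (cmod (snd z))\<^sup>2" by (simp add: norm_prod_def)
    then have "(cmod (fst z))\<^sup>2 / (norm z)\<^sup>2 + (cmod (snd z))\<^sup>2 / (norm z)\<^sup>2 = (norm z)\<^sup>2 / (norm z)\<^sup>2"
      by (simp only: add_divide_distrib)
    then show ?thesis
      using that by (simp add: norm_divide power_divide)
  qed
  then show "?f \<in> space (restrict_space lborel ?A) \<rightarrow> SU2"
    by (force simp: space_restrict_space SU2_def)
  have "continuous_on ?A ?f" by (intro continuous_on_su2_mat continuous_intros) auto
  then have "?f \<in> borel_measurable (restrict_space borel ?A)"
    by (rule borel_measurable_continuous_on_restrict)
  then show "?f \<in> borel_measurable (restrict_space lborel ?A)"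
    by (simp add: measurable_def space_restrict_space sets_restrict_space)
qed

theorem emeasure_su2_volume: "emeasure su2_volume SU2 = ennreal (16 * pi\<^sup>2)"
proof -
  let ?A = "{z :: complex \<times> complex. 0 < norm z \<and> norm z \<le> 2}"
  let ?N = "restrict_space lborel ?A"
  let ?f = "\<lambda>z. su2_mat (fst z / of_real (norm z)) (snd z / of_real (norm z))"
  have A: "?A = cball 0 2 - {0}" by auto
  have "emeasure (distr ?N su2_borel ?f) SU2 = emeasure ?N (?f -` SU2 \<inter> space ?N)"
    by (intro emeasure_distr measurable_su2_projection)
       (auto simp: sets_restrict_space intro!: image_eqI[of _ _ UNIV])
  also have "?f -` SU2 \<inter> space ?N = ?A"
    using measurable_space[OF measurable_su2_projection]
    by (auto simp: space_restrict_space)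
  also have "emeasure ?N ?A = emeasure lborel ?A"
    by (subst emeasure_restrict_space) (auto simp: A)
  also have "\<dots> = emeasure lborel (cball (0 :: complex \<times> complex) 2) - emeasure lborel {0 :: complex \<times> complex}"
    unfolding A by (rule emeasure_Diff) auto
  also have "\<dots> = ennreal (8 * pi\<^sup>2)"
    by (subst emeasure_cball) (auto simp: unit_ball_vol_numeral)
  finally have "emeasure (distr ?N su2_borel ?f) SU2 = ennreal (8 * pi\<^sup>2)" .
  then have "emeasure su2_volume SU2 = 2 * ennreal (8 * pi\<^sup>2)"
    by (simp add: su2_volume_def)
  also have "\<dots> = ennreal (2 * (8 * pi\<^sup>2))"
    by (subst ennreal_mult) auto
  finally show ?thesis by simp
qed

end

(* A bi-invariant field has a coefficient matrix a whose law is unchanged when its rows are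
   transformed by the unitary Wigner matrix D(h): a_{m,k} becomes sum_s a_{m,s} D_{k,s}(h).
   For the diagonal matrices h = g3(t) this multiplies the s-component by exp(-i s t), so every
   moment E(X_s(g) X_s'(g')) and E(X_s(g) conj X_s'(g')) with s' different from s and -s picks up
   a nontrivial phase and vanishes.  For the mass ratios T_s = E(|X_s|^2 / |X|^2), rotating by
   h g3(t) and averaging over t removes the cross terms and gives T_k = sum_s |D_{k,s}(h)|^2 T_s.
   This is a fixed point of a stochastic matrix, and for a suitable h its column s = l is
   positive, so T is constant by the maximum principle.  Averages over t are finite sums over the
   nodes of a discrete Fourier transform. *)
theory Submission
  imports Defs
begin

text \<open>The main obstacle lies between the field and its coefficients. Invariance is a statement
  about a law on a product \<open>\<sigma>\<close>-algebra, which sees only countably many values of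
  the field, while masses are integrals over \<open>SU2\<close>. In the span of the
  \<open>phi l m s\<close> finitely many values suffice: left and right translations by
  \<open>g3\<close> separate the indices m and s, and one point where \<open>phi l m s\<close> does
  not vanish fixes the scale. To express masses by coefficients, one has to know that the norm of a
  Wigner function depends on its row m alone. Right translations mix coefficients within a row
  unitarily, so they then preserve the total mass. This independence of s comes from the same
  maximum principle, with \<open>su2_volume\<close> in place of the probability measure. Averages
  over 2 l + 1 equidistant angles are exact because differences of weights are integers of absolute
  value at most 2 l, also for half-integral l. The row and the column of weight l in D(h) consist of
  nonzero multiples of monomials in the entries of h and their conjugates, so an h without zero
  entries makes them positive in modulus.\<close>

section \<open>Invariance of the volume of SU2\<close>

text \<open>Uniqueness of translation invariant measures: with \<open>\<mu> = distr lborel borel f\<close> and \<open>B\<close> the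
  unit ball, evaluating \<open>\<integral>\<integral> 1\<^sub>A (x + y) 1\<^sub>B y \<mu>(dx) dy\<close> in both orders gives
  \<open>\<mu> A * lborel B = lborel A * \<mu> B\<close>, and \<open>\<mu> B = lborel B\<close> as \<open>f\<close> preserves the norm.\<close>
lemma lborel_distr_linear_isometry:
  fixes f :: "'a::euclidean_space \<Rightarrow> 'a"
  assumes f: "linear f" and norm_f: "\<And>x. norm (f x) = norm x"
  shows "distr lborel borel f = lborel"
proof -
  define \<mu> where "\<mu> = distr lborel borel f"
  have meas_f [measurable]: "f \<in> borel_measurable borel"
    using f by (intro borel_measurable_continuous_onI linear_continuous_on)
      (simp add: linear_conv_bounded_linear)
  have "inj f" using f norm_f by (metis linear_injective_0 norm_eq_zero)
  then have "surj f" using f by (simp add: linear_injective_imp_surjective)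
  have sets_\<mu> [measurable_cong, simp]: "sets \<mu> = sets borel" "space \<mu> = UNIV"
    by (auto simp: \<mu>_def)
  have em: "emeasure \<mu> A = emeasure lborel (f -` A)" if "A \<in> sets borel" for A
    using that by (simp add: \<mu>_def emeasure_distr)
  have cball: "emeasure \<mu> (cball 0 r) = emeasure lborel (cball (0::'a) r)" for r
  proof -
    have "f -` cball 0 r = cball 0 r" by (auto simp: norm_f)
    then show ?thesis by (simp add: em)
  qed
  \<comment> \<open>Required for exchanging the integrals. Balls around 0 exhaust the space, and
    they are their own preimages under \<open>f\<close>, so their mass is finite.\<close>
  interpret \<mu>: sigma_finite_measure \<mu>
  proof
    show "\<exists>A. countable A \<and> A \<subseteq> sets \<mu> \<and> \<Union> A = space \<mu> \<and> (\<forall>a\<in>A. emeasure \<mu> a \<noteq> \<infinity>)"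
    proof (intro exI conjI)
      show "countable (range (\<lambda>n::nat. cball (0::'a) (real n)))" by simp
      show "range (\<lambda>n::nat. cball (0::'a) (real n)) \<subseteq> sets \<mu>" by auto
      show "\<Union> (range (\<lambda>n::nat. cball (0::'a) (real n))) = space \<mu>"
        by (auto simp: real_arch_simple)
      show "\<forall>a\<in>range (\<lambda>n::nat. cball (0::'a) (real n)). emeasure \<mu> a \<noteq> \<infinity>"
        using emeasure_lborel_cball_finite[of "0::'a"] by (auto simp: cball less_top)
    qed
  qed
  interpret pair_sigma_finite \<mu> lborel ..
  have lborel_shift: "(\<integral>\<^sup>+ x. h (x + v) \<partial>lborel) = (\<integral>\<^sup>+ x. h x \<partial>lborel)"
    if [measurable]: "h \<in> borel_measurable borel" for h and v :: 'a
  proof -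
    have "(\<integral>\<^sup>+ x. h x \<partial>lborel) = (\<integral>\<^sup>+ x. h x \<partial>distr lborel borel ((+) v))"
      by (simp add: lborel_distr_plus)
    also have "\<dots> = (\<integral>\<^sup>+ x. h (x + v) \<partial>lborel)"
      by (subst nn_integral_distr) (auto simp: add.commute)
    finally show ?thesis by simp
  qed
  have \<mu>_shift: "(\<integral>\<^sup>+ x. h (x + v) \<partial>\<mu>) = (\<integral>\<^sup>+ x. h x \<partial>\<mu>)"
    if [measurable]: "h \<in> borel_measurable borel" for h and v :: 'a
  proof -
    \<comment> \<open>By surjectivity a shift by \<open>v\<close> after \<open>f\<close> is a shift
      by \<open>w\<close> before \<open>f\<close>, which Lebesgue measure absorbs.\<close>
    obtain w where w: "v = f w" using \<open>surj f\<close> by auto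
    have "(\<integral>\<^sup>+ x. h (x + v) \<partial>\<mu>) = (\<integral>\<^sup>+ x. h (f (x + w)) \<partial>lborel)"
      unfolding \<mu>_def by (subst nn_integral_distr) (auto simp: w linear_add[OF f])
    also have "\<dots> = (\<integral>\<^sup>+ x. h x \<partial>\<mu>)"
      unfolding \<mu>_def by (subst nn_integral_distr) (auto intro!: lborel_shift)
    finally show ?thesis .
  qed
  let ?B = "cball (0::'a) 1"
  have [measurable]: "?B \<in> sets borel" by simp
  have "lborel = \<mu>"
  proof (rule measure_eqI)
    fix A :: "'a set" assume "A \<in> sets lborel"
    then have A [measurable]: "A \<in> sets borel" by simp
    have "emeasure \<mu> A * emeasure lborel ?B
        = (\<integral>\<^sup>+ y. (\<integral>\<^sup>+ x. indicator A (x + y) * indicator ?B y \<partial>\<mu>) \<partial>lborel)"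
      using \<mu>_shift[of "indicator A"] nn_integral_cmult_indicator[of ?B lborel "emeasure \<mu> A"]
      by (simp add: nn_integral_multc)
    also have "\<dots> = (\<integral>\<^sup>+ x. (\<integral>\<^sup>+ y. indicator A (x + y) * indicator ?B y \<partial>lborel) \<partial>\<mu>)"
      by (rule Fubini') measurable
    also have "\<dots> = (\<integral>\<^sup>+ x. (\<integral>\<^sup>+ y. indicator A y * indicator ?B (y - x) \<partial>lborel) \<partial>\<mu>)"
    proof (rule nn_integral_cong)
      fix x
      show "(\<integral>\<^sup>+ y. indicator A (x + y) * indicator ?B y \<partial>lborel)
          = (\<integral>\<^sup>+ y. indicator A y * indicator ?B (y - x) \<partial>lborel)"
        using lborel_shift[of "\<lambda>y. indicator A y * indicator ?B (y - x)" x]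
        by (simp add: add.commute)
    qed
    also have "\<dots> = (\<integral>\<^sup>+ y. (\<integral>\<^sup>+ x. indicator A y * indicator ?B (y - x) \<partial>\<mu>) \<partial>lborel)"
      by (rule Fubini'[symmetric]) measurable
    also have "\<dots> = (\<integral>\<^sup>+ y. indicator A y * emeasure \<mu> ?B \<partial>lborel)"
    proof (rule nn_integral_cong)
      fix y
      have "(\<integral>\<^sup>+ x. indicator ?B (y - x) \<partial>\<mu>) = (\<integral>\<^sup>+ x. indicator ?B (x + (- y)) \<partial>\<mu>)"
        by (intro nn_integral_cong) (auto simp: indicator_def norm_minus_commute)
      also have "\<dots> = emeasure \<mu> ?B" by (subst \<mu>_shift) auto
      finally show "(\<integral>\<^sup>+ x. indicator A y * indicator ?B (y - x) \<partial>\<mu>)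
          = indicator A y * emeasure \<mu> ?B"
        by (simp add: nn_integral_cmult)
    qed
    also have "\<dots> = emeasure lborel A * emeasure lborel ?B"
      by (simp add: nn_integral_multc cball)
    finally have eq: "emeasure \<mu> A * emeasure lborel ?B = emeasure lborel A * emeasure lborel ?B" .
    have "emeasure lborel ?B \<noteq> 0" "emeasure lborel ?B \<noteq> \<top>"
      using emeasure_lborel_cball_finite[of "0::'a" 1]
      by (auto simp: emeasure_cball unit_ball_vol_pos less_imp_neq ennreal_eq_0_iff not_le)
    with eq show "emeasure lborel A = emeasure \<mu> A"
      by (metis ennreal_mult_divide_eq)
  qed simp
  then show ?thesis by (simp add: \<mu>_def)
qed

section \<open>The group law of \<open>SU2\<close> in terms of first columns\<close>

lemma SU2_iff: "g \<in> SU2 \<longleftrightarrow> (\<exists>\<alpha> \<beta>. g = su2_mat \<alpha> \<beta> \<and> (cmod \<alpha>)\<^sup>2 + (cmod \<beta>)\<^sup>2 = 1)"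
  by (auto simp: SU2_def)

lemma su2_mat_mult:
  "su2_mat a b ** su2_mat c d = su2_mat (a * c - cnj b * d) (b * c + cnj a * d)"
  by (simp add: su2_mat_def matrix_matrix_mult_def vec_eq_iff forall_2 UNIV_2 algebra_simps)

text \<open>Multiplicativity of the determinant, which is also the squared norm of a
  quaternion.\<close>

lemma norm_su2_mult:
  "(cmod (a * c - cnj b * d))\<^sup>2 + (cmod (b * c + cnj a * d))\<^sup>2
    = ((cmod a)\<^sup>2 + (cmod b)\<^sup>2) * ((cmod c)\<^sup>2 + (cmod d)\<^sup>2)"
  by (simp add: cmod_power2) algebra

lemma SU2_mult [simp]: "g \<in> SU2 \<Longrightarrow> h \<in> SU2 \<Longrightarrow> g ** h \<in> SU2"
  unfolding SU2_iff by (metis norm_su2_mult su2_mat_mult mult_1)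

text \<open>The matrix on the right is the conjugate transpose, hence the inverse.\<close>

lemma SU2_adjoint: "su2_mat a b \<in> SU2 \<Longrightarrow> su2_mat (cnj a) (- b) \<in> SU2"
  unfolding SU2_iff by (force simp: su2_mat_def vec_eq_iff forall_2)

lemma g3_eq: "g3 \<psi> = su2_mat (cis (\<psi> / 2)) 0"
  by (simp add: g3_def su2_mat_def cis_cnj)

lemma g3_SU2 [simp]: "g3 \<psi> \<in> SU2"
  unfolding g3_eq SU2_iff by (rule exI, rule exI, rule conjI[OF refl]) simp

lemma mat_1_eq: "mat 1 = su2_mat 1 0"
  by (simp add: su2_mat_def mat_def vec_eq_iff forall_2)

lemma mat_1_SU2 [simp]: "mat 1 \<in> SU2"
  unfolding mat_1_eq SU2_iff by (rule exI, rule exI, rule conjI[OF refl]) simp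

lemma matrix_inv_mat_1: "matrix_inv (mat 1 :: complex^2^2) = mat 1"
proof -
  have "invertible (mat 1 :: complex^2^2)" by (auto simp: invertible_def intro: exI[of _ "mat 1"])
  then have "mat 1 ** matrix_inv (mat 1) = (mat 1 :: complex^2^2)"
    unfolding matrix_inv_def invertible_def by (rule someI2_ex) simp
  then show ?thesis by simp
qed

section \<open>Translation invariance of the volume\<close>

lemma space_su2_volume [simp]: "space su2_volume = SU2"
  by (simp add: su2_volume_def space_scale_measure space_restrict_space)

lemma sets_su2_volume [simp, measurable_cong]: "sets su2_volume = sets su2_borel"
  by (simp add: su2_volume_def)

lemma finite_measure_su2_volume: "finite_measure su2_volume"
  by (rule finite_measureI) (simp add: emeasure_su2_volume)

text \<open>Up to a factor, \<open>su2_volume\<close> is the image of Lebesgue measure on a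
  punctured ball under radial projection. A linear isometry preserves the ball and its Lebesgue
  measure and commutes with the projection, so the map it induces on \<open>SU2\<close> preserves
  the volume.\<close>

lemma distr_su2_volume:
  fixes f :: "complex \<times> complex \<Rightarrow> complex \<times> complex"
  assumes f: "linear f" and norm_f: "\<And>z. norm (f z) = norm z"
    and T: "\<And>z. T (su2_mat (fst z) (snd z)) = su2_mat (fst (f z)) (snd (f z))"
    and [measurable]: "T \<in> measurable su2_borel su2_borel"
  shows "distr su2_volume su2_borel T = su2_volume"
proof (rule measure_eqI)
  let ?A = "{z :: complex \<times> complex. 0 < norm z \<and> norm z \<le> 2}"
  let ?N = "restrict_space lborel ?A"
  let ?p = "\<lambda>z. su2_mat (fst z / of_real (norm z)) (snd z / of_real (norm z))"
  have A: "?A = cball 0 2 - {0}" by auto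
  have meas_f [measurable]: "f \<in> borel_measurable borel"
    using f by (intro borel_measurable_continuous_onI linear_continuous_on)
      (simp add: linear_conv_bounded_linear)
  \<comment> \<open>Only a real scalar has to pass through \<open>f\<close>; real linearity is all
    that right translations offer.\<close>
  have Tp: "T (?p z) = ?p (f z)" for z
  proof -
    let ?w = "(fst z / of_real (norm z), snd z / of_real (norm z))"
    have "?w = (1 / norm z) *\<^sub>R z"
      by (cases z) (simp add: scaleR_conv_of_real field_simps)
    then have "f ?w = (1 / norm z) *\<^sub>R f z" using f by (simp add: linear_scale)
    then show ?thesis using T[of ?w]
      by (simp add: norm_f scaleR_conv_of_real field_simps)
  qed
  have vol: "emeasure su2_volume B = 2 * emeasure lborel {z \<in> ?A. ?p z \<in> B}"
    and pre: "{z \<in> ?A. ?p z \<in> B} \<in> sets borel"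
    if "B \<in> sets su2_borel" for B
  proof -
    have *: "?p -` B \<inter> space ?N = {z \<in> ?A. ?p z \<in> B}"
      by (auto simp: space_restrict_space)
    have "{z \<in> ?A. ?p z \<in> B} \<in> sets ?N"
      unfolding *[symmetric] using measurable_su2_projection that by (rule measurable_sets)
    moreover have "?A \<inter> space lborel \<in> sets lborel" unfolding A by simp
    ultimately show "{z \<in> ?A. ?p z \<in> B} \<in> sets borel"
      by (simp only: sets_restrict_space_iff sets_lborel)
    show "emeasure su2_volume B = 2 * emeasure lborel {z \<in> ?A. ?p z \<in> B}"
      unfolding su2_volume_def emeasure_scale_measure
        emeasure_distr[OF measurable_su2_projection that] *
      by (subst emeasure_restrict_space) (auto simp: A)
  qed
  show "sets (distr su2_volume su2_borel T) = sets su2_volume" by simp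
  fix B assume "B \<in> sets (distr su2_volume su2_borel T)"
  then have B: "B \<in> sets su2_borel" by simp
  have SU2: "?p z \<in> SU2" if "z \<in> ?A" for z
    using measurable_space[OF measurable_su2_projection, of z] that
    by (simp add: space_restrict_space)
  have TB: "T -` B \<inter> SU2 \<in> sets su2_borel"
    using measurable_sets[OF assms(4) B] by (simp add: space_restrict_space)
  have "emeasure (distr su2_volume su2_borel T) B = emeasure su2_volume (T -` B \<inter> SU2)"
    using B by (subst emeasure_distr) auto
  also have "\<dots> = 2 * emeasure lborel {z \<in> ?A. ?p z \<in> T -` B \<inter> SU2}"
    using TB by (rule vol)
  also have "{z \<in> ?A. ?p z \<in> T -` B \<inter> SU2} = f -` {z \<in> ?A. ?p z \<in> B}"
  proof (rule set_eqI)
    fix z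
    show "z \<in> {z \<in> ?A. ?p z \<in> T -` B \<inter> SU2} \<longleftrightarrow> z \<in> f -` {z \<in> ?A. ?p z \<in> B}"
      using SU2[of z] by (simp only: vimage_eq mem_Collect_eq Int_iff Tp norm_f) blast
  qed
  also have "emeasure lborel (f -` {z \<in> ?A. ?p z \<in> B})
      = emeasure (distr lborel borel f) {z \<in> ?A. ?p z \<in> B}"
    using pre[OF B] by (subst emeasure_distr) auto
  also have "2 * \<dots> = emeasure su2_volume B"
    using B by (simp only: lborel_distr_linear_isometry[OF f norm_f] vol)
  finally show "emeasure (distr su2_volume su2_borel T) B = emeasure su2_volume B" .
qed

lemma measurable_matrix_mult_SU2:
  assumes "h \<in> SU2"
  shows "(\<lambda>g. h ** g) \<in> measurable su2_borel su2_borel"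
    and "(\<lambda>g. g ** h) \<in> measurable su2_borel su2_borel"
proof -
  have *: "continuous_on UNIV (\<lambda>g::complex^2^2. h ** g)"
      "continuous_on UNIV (\<lambda>g::complex^2^2. g ** h)"
    unfolding matrix_matrix_mult_def by (intro continuous_intros)+
  show "(\<lambda>g. h ** g) \<in> measurable su2_borel su2_borel"
    using assms *(1) by (intro measurable_restrict_space2 measurable_restrict_space1
        borel_measurable_continuous_onI) (auto simp: space_restrict_space)
  show "(\<lambda>g. g ** h) \<in> measurable su2_borel su2_borel"
    using assms *(2) by (intro measurable_restrict_space2 measurable_restrict_space1
        borel_measurable_continuous_onI) (auto simp: space_restrict_space)
qed

text \<open>On first columns both translations are linear isometries of
  \<open>complex \<times> complex\<close>. The right one conjugates coordinates and so is linear
  over the reals only.\<close>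

lemma distr_su2_volume_mult:
  assumes h: "h \<in> SU2"
  shows "distr su2_volume su2_borel (\<lambda>g. h ** g) = su2_volume"
    and "distr su2_volume su2_borel (\<lambda>g. g ** h) = su2_volume"
proof -
  obtain a b where ab: "h = su2_mat a b" "(cmod a)\<^sup>2 + (cmod b)\<^sup>2 = 1"
    using h by (auto simp: SU2_iff)
  let ?L = "\<lambda>z. (a * fst z - cnj b * snd z, b * fst z + cnj a * snd z)"
  let ?R = "\<lambda>z. (fst z * a - cnj (snd z) * b, snd z * a + cnj (fst z) * b)"
  show "distr su2_volume su2_borel (\<lambda>g. h ** g) = su2_volume"
  proof (rule distr_su2_volume[of ?L])
    show "linear ?L" by (rule linearI) (auto simp: algebra_simps)
    show "norm (?L z) = norm z" for z
      by (simp add: norm_prod_def norm_su2_mult ab)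
  qed (use h in \<open>auto simp: ab su2_mat_mult intro: measurable_matrix_mult_SU2\<close>)
  show "distr su2_volume su2_borel (\<lambda>g. g ** h) = su2_volume"
  proof (rule distr_su2_volume[of ?R])
    show "linear ?R" by (rule linearI) (auto simp: algebra_simps)
    show "norm (?R z) = norm z" for z
      by (simp add: norm_prod_def norm_su2_mult ab)
  qed (use h in \<open>auto simp: ab su2_mat_mult intro: measurable_matrix_mult_SU2\<close>)
qed

lemma integral_su2_volume_mult:
  fixes F :: "complex^2^2 \<Rightarrow> 'b::{banach, second_countable_topology}"
  assumes h: "h \<in> SU2" and F: "F \<in> borel_measurable su2_borel"
  shows "(LINT g|su2_volume. F (h ** g)) = (LINT g|su2_volume. F g)"
    and "(LINT g|su2_volume. F (g ** h)) = (LINT g|su2_volume. F g)"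
proof -
  note [measurable] = measurable_matrix_mult_SU2[OF h] F
  show "(LINT g|su2_volume. F (h ** g)) = (LINT g|su2_volume. F g)"
    using integral_distr[of "\<lambda>g. h ** g" su2_volume su2_borel F]
    by (simp add: distr_su2_volume_mult[OF h])
  show "(LINT g|su2_volume. F (g ** h)) = (LINT g|su2_volume. F g)"
    using integral_distr[of "\<lambda>g. g ** h" su2_volume su2_borel F]
    by (simp add: distr_su2_volume_mult[OF h])
qed

section \<open>Discrete Fourier analysis on the weights\<close>

text \<open>At t = pi / c the phase is -1.\<close>

lemma eq_0_if_cis_mult:
  assumes "\<And>t. v = cis (c * t) * v" "c \<noteq> 0"
  shows "v = 0"
  using assms(1)[of "pi / c"] assms(2) by simp

text \<open>Where \<open>f\<close> is maximal, its value is a convex combination of values that are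
  not larger, so all values carrying positive weight agree with it. Each row gives \<open>s0\<close>
  positive weight; hence \<open>f s0\<close> is the maximum and, by the same argument for - f, the
  minimum.\<close>

lemma constant_if_stochastic_fixed_point:
  fixes f :: "'a \<Rightarrow> real"
  assumes "finite S" and p0: "\<And>k s. k \<in> S \<Longrightarrow> s \<in> S \<Longrightarrow> 0 \<le> p k s"
    and p1: "\<And>k. k \<in> S \<Longrightarrow> (\<Sum>s\<in>S. p k s) = 1"
    and pos: "\<And>k. k \<in> S \<Longrightarrow> 0 < p k s0"
    and s0: "s0 \<in> S" and fp: "\<And>k. k \<in> S \<Longrightarrow> f k = (\<Sum>s\<in>S. p k s * f s)"
    and k: "k \<in> S"
  shows "f k = f s0"
proof -
  have extremal: "g s0 = g j"
    if j: "j \<in> S" and max: "\<And>s. s \<in> S \<Longrightarrow> g s \<le> g j"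
      and gfix: "\<And>k. k \<in> S \<Longrightarrow> g k = (\<Sum>s\<in>S. p k s * g s)" for g :: "'a \<Rightarrow> real" and j
  proof -
    have "(\<Sum>s\<in>S. p j s * (g j - g s)) = 0"
      using p1[OF j] gfix[OF j]
      by (simp add: right_diff_distrib sum_subtractf flip: sum_distrib_right)
    then have "\<forall>s\<in>S. p j s * (g j - g s) = 0"
      using \<open>finite S\<close> p0[OF j] max by (subst (asm) sum_nonneg_eq_0_iff) auto
    then show ?thesis using pos[OF j] s0 by force
  qed
  have "Max (f ` S) \<in> f ` S" "Min (f ` S) \<in> f ` S" using \<open>finite S\<close> s0 by (auto intro!: Max_in Min_in)
  then obtain i j where ij: "i \<in> S" "j \<in> S" "f i = Max (f ` S)" "f j = Min (f ` S)"
    by (metis imageE)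
  have "f s0 = f i"
    using ij \<open>finite S\<close> by (intro extremal fp) simp_all
  moreover have "- f s0 = - f j"
  proof (rule extremal[of j "\<lambda>s. - f s"])
    show "- f k = (\<Sum>s\<in>S. p k s * - f s)" if "k \<in> S" for k
      by (simp only: fp[OF that] mult_minus_right sum_negf)
  qed (use ij \<open>finite S\<close> in simp_all)
  moreover have "f j \<le> f k" "f k \<le> f i" using ij \<open>finite S\<close> k by auto
  ultimately show ?thesis by simp
qed

text \<open>Arguments of the N-th roots of unity, N being the number 2 l + 1 of weights. This is the
  smallest N exceeding every difference of two weights.\<close>

definition node :: "real \<Rightarrow> nat \<Rightarrow> real" where
  "node l j = 2 * pi * real j / real (card (weights l))"

context
  fixes l :: real
  assumes l: "2 * l \<in> \<nat>"
begin

lemma finite_weights [simp]: "finite (weights l)"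
  by (simp add: weights_eq[OF l])

lemma card_weights: "card (weights l) = Suc (nat \<lfloor>2 * l\<rfloor>)"
  unfolding weights_eq[OF l] by (subst card_image) (auto simp: inj_on_def)

lemma weightsE:
  assumes "m \<in> weights l"
  obtains k n where "m = - l + real k" "2 * l = real n" "k \<le> n"
    "nat \<lfloor>2 * l\<rfloor> = n" "nat \<lfloor>l + m\<rfloor> = k" "nat \<lfloor>l - m\<rfloor> = n - k"
proof -
  obtain n where n: "2 * l = real n" using l by (auto elim: Nats_cases)
  then have n': "nat \<lfloor>2 * l\<rfloor> = n" by simp
  obtain k where k: "m = - l + real k" "k \<le> n"
    using assms unfolding weights_eq[OF l] n' by auto
  have "l + m = real k" "l - m = real (n - k)" using n k by auto
  then have "nat \<lfloor>l + m\<rfloor> = k" "nat \<lfloor>l - m\<rfloor> = n - k" by (simp_all only: floor_of_nat nat_int)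
  then show ?thesis by (rule that[OF k(1) n k(2) n'])
qed

lemma weights_nonneg: "0 \<le> l"
proof -
  obtain n where "2 * l = real n" using l by (auto elim: Nats_cases)
  then show ?thesis by simp
qed

lemma top_weight [simp]: "l \<in> weights l"
proof -
  obtain n where n: "2 * l = real n" using l by (auto elim: Nats_cases)
  then show ?thesis unfolding weights_def by (auto intro!: exI[of _ n])
qed

text \<open>The difference d of two weights is an integer with |d| < N, so the summands are the
  powers of an N-th root of unity, which is 1 only for d = 0. The geometric sum vanishes otherwise.
  Half-integral weights fit in because only differences occur.\<close>

lemma dft_orthogonality:
  assumes "m \<in> weights l" "m' \<in> weights l"
  shows "(\<Sum>j<card (weights l). cis ((m - m') * node l j))
    = (if m = m' then of_nat (card (weights l)) else 0)"
proof (cases "m = m'")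
  case False
  let ?N = "card (weights l)"
  obtain k n where k: "m = - l + real k" "2 * l = real n" "k \<le> n" using assms(1) by (rule weightsE)
  obtain k' n' where k': "m' = - l + real k'" "2 * l = real n'" "k' \<le> n'"
    using assms(2) by (rule weightsE)
  have N: "?N = Suc n" using k by (simp add: card_weights)
  define d where "d = int k - int k'"
  have d: "m - m' = of_int d" "\<bar>d\<bar> < int ?N" "d \<noteq> 0"
    using k k' N False by (auto simp: d_def)
  let ?w = "cis (2 * pi * (of_int d / real ?N))"
  have powers: "cis ((m - m') * node l j) = ?w ^ j" for j
    by (subst Complex.DeMoivre) (simp add: node_def d mult_ac)
  have "?w \<noteq> 1"
  proof
    assume "?w = 1"
    then have "cos (2 * pi * (of_int d / real ?N)) = 1" by (simp add: complex_eq_iff)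
    then obtain i :: int where "2 * pi * (of_int d / real ?N) = of_int i * 2 * pi"
      by (auto simp: cos_one_2pi_int)
    then have "2 * pi * (of_int d / real ?N) = 2 * pi * of_int i" by (simp only: mult_ac)
    then have "of_int d / real ?N = of_int i" by (subst (asm) mult_cancel_left) simp
    then have "of_int d = of_int i * real ?N" using N by (simp add: divide_eq_eq)
    then have "d = i * int ?N" by (metis of_int_eq_iff of_int_mult of_int_of_nat_eq)
    then have "\<bar>d\<bar> = \<bar>i\<bar> * int ?N" by (simp add: abs_mult)
    moreover have "\<bar>i\<bar> \<ge> 1" using \<open>d = i * int ?N\<close> \<open>d \<noteq> 0\<close> by auto
    ultimately show False using d(2) by (smt (verit) mult_right_mono mult_cancel_right1 of_nat_0_le_iff mult_1)
  qed
  moreover have "?w ^ ?N = 1"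
  proof -
    have "real ?N * (2 * pi * (of_int d / real ?N)) = 2 * pi * of_int d" using N by simp
    then show ?thesis by (simp only: Complex.DeMoivre cis_multiple_2pi Ints_of_int)
  qed
  ultimately show ?thesis using False by (simp add: powers sum_gp_strict)
qed simp

lemma dft_parseval:
  fixes c :: "real \<Rightarrow> complex"
  shows "(\<Sum>j<card (weights l). (cmod (\<Sum>m\<in>weights l. c m * cis (- m * node l j)))\<^sup>2)
    = real (card (weights l)) * (\<Sum>m\<in>weights l. (cmod (c m))\<^sup>2)"
proof -
  let ?N = "card (weights l)"
  have "complex_of_real (\<Sum>j<?N. (cmod (\<Sum>m\<in>weights l. c m * cis (- m * node l j)))\<^sup>2)
    = (\<Sum>j<?N. \<Sum>m\<in>weights l. \<Sum>m'\<in>weights l. c m * cnj (c m') * cis ((m' - m) * node l j))"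
    by (simp add: complex_norm_square sum_product cis_cnj algebra_simps cis_mult
        flip: of_real_power cis_divide)
  also have "\<dots> = (\<Sum>m\<in>weights l. \<Sum>m'\<in>weights l. c m * cnj (c m') *
      (\<Sum>j<?N. cis ((m' - m) * node l j)))"
    by (subst sum.swap, rule sum.cong[OF refl], subst sum.swap) (simp add: sum_distrib_left)
  also have "\<dots> = (\<Sum>m\<in>weights l. c m * cnj (c m) * of_nat ?N)"
    by (intro sum.cong refl) (simp add: dft_orthogonality if_distrib[of "\<lambda>x. _ * x"] cong: if_cong)
  also have "\<dots> = complex_of_real (real ?N * (\<Sum>m\<in>weights l. (cmod (c m))\<^sup>2))"
    by (simp add: complex_norm_square sum_distrib_left mult_ac flip: of_real_power)
  finally show ?thesis by (simp only: of_real_eq_iff)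
qed

lemma dft_coefficient:
  fixes c :: "real \<Rightarrow> complex"
  assumes m: "m \<in> weights l"
  shows "(\<Sum>j<card (weights l). cis (m * node l j) * (\<Sum>k\<in>weights l. c k * cis (- k * node l j)))
    = of_nat (card (weights l)) * c m"
proof -
  let ?N = "card (weights l)"
  have "(\<Sum>j<?N. cis (m * node l j) * (\<Sum>k\<in>weights l. c k * cis (- k * node l j)))
      = (\<Sum>j<?N. \<Sum>k\<in>weights l. c k * cis ((m - k) * node l j))"
    by (simp add: sum_distrib_left left_diff_distrib mult_ac cis_mult)
  also have "\<dots> = (\<Sum>k\<in>weights l. c k * (\<Sum>j<?N. cis ((m - k) * node l j)))"
    by (subst sum.swap) (simp add: sum_distrib_left)
  also have "\<dots> = of_nat ?N * c m"
    using m by (simp add: dft_orthogonality if_distrib[of "\<lambda>x. _ * x"] cong: if_cong)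
  finally show ?thesis .
qed

end

section \<open>The Wigner matrix is a unitary representation\<close>

context
  fixes l :: real
  assumes l: "2 * l \<in> \<nat>"
begin

lemma psi_cis:
  assumes "m \<in> weights l"
  shows "psi l m (cis t) 1 = psi l m 1 1 * cis ((l + m) * t)"
  using assms by (rule weightsE[OF l]) (simp add: psi_def Complex.DeMoivre)

lemma psi_1_1_nonzero:
  assumes "m \<in> weights l"
  shows "psi l m 1 1 \<noteq> 0"
  using assms by (rule weightsE[OF l]) (simp add: psi_def)

text \<open>At the points (cis t, 1) the functions \<open>psi l k\<close> become characters with the
  integer frequencies l + k. Coefficients of an expansion are therefore Fourier coefficients of its
  values at the nodes.\<close>

lemma psi_dft:
  assumes m: "m \<in> weights l"
  shows "(\<Sum>j<card (weights l). cis (- (l + m) * node l j) *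
      (\<Sum>k\<in>weights l. psi l k (cis (node l j)) 1 * c k))
    = of_nat (card (weights l)) * psi l m 1 1 * c m"
proof -
  let ?N = "card (weights l)"
  have "(\<Sum>j<?N. cis (- (l + m) * node l j) * (\<Sum>k\<in>weights l. psi l k (cis (node l j)) 1 * c k))
      = (\<Sum>j<?N. \<Sum>k\<in>weights l. psi l k 1 1 * c k * cis ((k - m) * node l j))"
    by (auto simp: sum_distrib_left psi_cis mult_ac cis_mult algebra_simps intro!: sum.cong)
  also have "\<dots> = (\<Sum>k\<in>weights l. psi l k 1 1 * c k * (\<Sum>j<?N. cis ((k - m) * node l j)))"
    by (subst sum.swap) (simp add: sum_distrib_left)
  also have "\<dots> = of_nat ?N * psi l m 1 1 * c m"
    using m by (simp add: dft_orthogonality l if_distrib[of "\<lambda>x. _ * x"] cong: if_cong)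
  finally show ?thesis .
qed

lemma psi_expansion_unique:
  assumes "\<And>z0 z1. (\<Sum>k\<in>weights l. psi l k z0 z1 * c k) = (\<Sum>k\<in>weights l. psi l k z0 z1 * d k)"
    and m: "m \<in> weights l"
  shows "c m = d m"
proof -
  have "of_nat (card (weights l)) * psi l m 1 1 * c m = of_nat (card (weights l)) * psi l m 1 1 * d m"
    unfolding psi_dft[OF m, symmetric] by (simp add: assms(1))
  moreover have "card (weights l) \<noteq> 0" by (simp add: card_weights l)
  ultimately show ?thesis using psi_1_1_nonzero[OF m] by simp
qed

text \<open>This explains the binomial roots in \<open>psi\<close>: they make the reproducing kernel
  a power of the Hermitian inner product of z and w, which is invariant under \<open>SU2\<close>.
  Unitarity of the Wigner matrix rests on this.\<close>

lemma psi_kernel: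
  "(\<Sum>m\<in>weights l. psi l m z0 z1 * cnj (psi l m w0 w1))
    = (z0 * cnj w0 + z1 * cnj w1) ^ nat \<lfloor>2 * l\<rfloor>"
proof -
  define n where "n = nat \<lfloor>2 * l\<rfloor>"
  have "(\<Sum>m\<in>weights l. psi l m z0 z1 * cnj (psi l m w0 w1))
      = (\<Sum>k\<le>n. (of_real (sqrt (real (n choose k))) * cnj (psi l (- l + real k) w0 w1)) * z0 ^ k * z1 ^ (n - k))"
    by (rule sum_psi_weights[OF l n_def])
  also have "\<dots> = (\<Sum>k\<le>n. of_nat (n choose k) * (z0 * cnj w0) ^ k * (z1 * cnj w1) ^ (n - k))"
  proof (rule sum.cong[OF refl])
    fix k assume "k \<in> {..n}"
    then have "- l + real k \<in> weights l" unfolding weights_eq[OF l] n_def by auto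
    then have psi: "psi l (- l + real k) w0 w1
        = of_real (sqrt (real (n choose k))) * w0 ^ k * w1 ^ (n - k)"
      by (rule weightsE[OF l]) (simp add: psi_def n_def)
    have "complex_of_real (sqrt (real (n choose k))) * of_real (sqrt (real (n choose k)))
        = of_nat (n choose k)"
      by (simp flip: of_real_mult)
    then show "(of_real (sqrt (real (n choose k))) * cnj (psi l (- l + real k) w0 w1)) * z0 ^ k * z1 ^ (n - k)
        = of_nat (n choose k) * (z0 * cnj w0) ^ k * (z1 * cnj w1) ^ (n - k)"
      unfolding psi by (simp add: power_mult_distrib mult_ac)
  qed
  also have "\<dots> = (z0 * cnj w0 + z1 * cnj w1) ^ n" by (rule binomial_ring[symmetric])
  finally show ?thesis by (simp add: n_def)
qed

text \<open>The substitution that defines the Wigner matrix of a product is the composition of the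
  substitutions of its factors; uniqueness of coefficients turns this into matrix
  multiplication.\<close>

lemma wignerD_su2_mat_mult:
  assumes m: "m \<in> weights l" and s: "s \<in> weights l"
  shows "wignerD l m s (su2_mat a b ** su2_mat c d)
    = (\<Sum>k\<in>weights l. wignerD l m k (su2_mat a b) * wignerD l k s (su2_mat c d))"
  unfolding su2_mat_mult
proof (rule wignerD_eqI[OF l m])
  show "wigner_identity l s (a * c - cnj b * d) (b * c + cnj a * d)
    (\<lambda>m. \<Sum>k\<in>weights l. wignerD l m k (su2_mat a b) * wignerD l k s (su2_mat c d))"
    unfolding wigner_identity_def
  proof (intro allI)
    fix z0 z1
    let ?w0 = "cnj a * z0 + cnj b * z1" and ?w1 = "- b * z0 + a * z1"
    have "(\<Sum>m\<in>weights l. psi l m z0 z1 *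
          (\<Sum>k\<in>weights l. wignerD l m k (su2_mat a b) * wignerD l k s (su2_mat c d)))
        = (\<Sum>k\<in>weights l. (\<Sum>m\<in>weights l. psi l m z0 z1 * wignerD l m k (su2_mat a b))
            * wignerD l k s (su2_mat c d))"
      unfolding sum_distrib_left sum_distrib_right by (subst sum.swap) (simp add: mult.assoc)
    also have "\<dots> = (\<Sum>k\<in>weights l. psi l k ?w0 ?w1 * wignerD l k s (su2_mat c d))"
      using wignerD_identity[OF l] by (intro sum.cong) (auto simp: wigner_identity_def)
    also have "\<dots> = psi l s (cnj c * ?w0 + cnj d * ?w1) (- d * ?w0 + c * ?w1)"
      using wignerD_identity[OF l s] by (simp only: wigner_identity_def)
    also have "\<dots> = psi l s (cnj (a * c - cnj b * d) * z0 + cnj (b * c + cnj a * d) * z1)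
        (- (b * c + cnj a * d) * z0 + (a * c - cnj b * d) * z1)"
      by (intro arg_cong2[of _ _ _ _ "psi l s"]) (simp_all add: algebra_simps)
    finally show "(\<Sum>m\<in>weights l. psi l m z0 z1 *
          (\<Sum>k\<in>weights l. wignerD l m k (su2_mat a b) * wignerD l k s (su2_mat c d)))
        = psi l s (cnj (a * c - cnj b * d) * z0 + cnj (b * c + cnj a * d) * z1)
        (- (b * c + cnj a * d) * z0 + (a * c - cnj b * d) * z1)" .
  qed
qed

lemma wignerD_mult:
  assumes "m \<in> weights l" "s \<in> weights l" "g \<in> SU2" "h \<in> SU2"
  shows "wignerD l m s (g ** h) = (\<Sum>k\<in>weights l. wignerD l m k g * wignerD l k s h)"
  using assms by (auto simp: SU2_iff wignerD_su2_mat_mult)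

text \<open>A diagonal element only scales the two variables, so each \<open>psi l s\<close> is an
  eigenvector. Its phase has the exponent - (l + s) / 2 + (l - s) / 2 = - s, multiplied by
  t.\<close>

lemma wignerD_g3:
  assumes m: "m \<in> weights l" and s: "s \<in> weights l"
  shows "wignerD l m s (g3 t) = (if m = s then cis (- s * t) else 0)"
  unfolding g3_eq
proof (rule wignerD_eqI[OF l m])
  have "psi l s (cis (- t / 2) * z0) (cis (t / 2) * z1) = cis (- s * t) * psi l s z0 z1" for z0 z1
    using s
  proof (rule weightsE[OF l])
    fix k n
    assume k: "s = - l + real k" "2 * l = real n" "k \<le> n"
      "nat \<lfloor>2 * l\<rfloor> = n" "nat \<lfloor>l + s\<rfloor> = k" "nat \<lfloor>l - s\<rfloor> = n - k"
    have "cis (- t / 2) ^ k * cis (t / 2) ^ (n - k) = cis (real k * (- t / 2) + real (n - k) * (t / 2))"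
      by (simp only: Complex.DeMoivre cis_mult)
    also have "real k * (- t / 2) + real (n - k) * (t / 2) = - s * t"
    proof -
      have s_eq: "s = real k - real n / 2" using k(1,2) by simp
      show ?thesis unfolding s_eq using k(3) by (simp add: of_nat_diff field_simps)
    qed
    finally show ?thesis
      unfolding psi_def k(4-6) by (simp add: power_mult_distrib mult_ac)
  qed
  then show "wigner_identity l s (cis (t / 2)) 0 (\<lambda>m. if m = s then cis (- s * t) else 0)"
    using s by (simp add: wigner_identity_def cis_cnj finite_weights[OF l] if_distrib[of "\<lambda>x. _ * x"] mult_ac cong: if_cong)
qed

lemma wignerD_mult_g3:
  assumes "m \<in> weights l" "s \<in> weights l" "g \<in> SU2"
  shows "wignerD l m s (g ** g3 t) = wignerD l m s g * cis (- s * t)"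
    and "wignerD l m s (g3 t ** g) = cis (- m * t) * wignerD l m s g"
  using assms by (simp_all add: wignerD_mult wignerD_g3 l if_distrib[of "\<lambda>x. _ * x"]
      if_distrib[of "\<lambda>x. x * _"] cong: if_cong)

text \<open>Let E be the product of the Wigner matrix with its adjoint. Inserting E into the kernel
  amounts to substituting in both arguments, which leaves the kernel unchanged, so E is the
  identity.\<close>

lemma wignerD_unitary_rows:
  assumes m: "m \<in> weights l" and m': "m' \<in> weights l" and g: "g \<in> SU2"
  shows "(\<Sum>s\<in>weights l. wignerD l m s g * cnj (wignerD l m' s g)) = (if m = m' then 1 else 0)"
proof -
  obtain a b where ab: "g = su2_mat a b" "(cmod a)\<^sup>2 + (cmod b)\<^sup>2 = 1"
    using g by (auto simp: SU2_iff)
  have norm1: "a * cnj a + b * cnj b = 1"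
    using ab(2) by (simp only: complex_norm_square[symmetric]) (metis of_real_1 of_real_add)
  let ?D = "\<lambda>m s. wignerD l m s g"
  let ?E = "\<lambda>m m'. \<Sum>s\<in>weights l. ?D m s * cnj (?D m' s)"
  have identity: "(\<Sum>m\<in>weights l. psi l m z0 z1 * ?D m s)
      = psi l s (cnj a * z0 + cnj b * z1) (- b * z0 + a * z1)" if "s \<in> weights l" for s z0 z1
    using wignerD_identity[OF l that] by (simp only: wigner_identity_def ab)
  have kernel: "(\<Sum>m\<in>weights l. psi l m z0 z1 * (\<Sum>m'\<in>weights l. ?E m m' * cnj (psi l m' w0 w1)))
      = (\<Sum>m\<in>weights l. psi l m z0 z1 * cnj (psi l m w0 w1))" for z0 z1 w0 w1
  proof -
    have "(\<Sum>m\<in>weights l. psi l m z0 z1 * (\<Sum>m'\<in>weights l. ?E m m' * cnj (psi l m' w0 w1)))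
        = (\<Sum>m\<in>weights l. \<Sum>m'\<in>weights l. \<Sum>s\<in>weights l.
            (psi l m z0 z1 * ?D m s) * cnj (psi l m' w0 w1 * ?D m' s))"
      by (simp add: sum_distrib_left sum_distrib_right mult_ac)
    also have "\<dots> = (\<Sum>s\<in>weights l. \<Sum>m\<in>weights l. \<Sum>m'\<in>weights l.
            (psi l m z0 z1 * ?D m s) * cnj (psi l m' w0 w1 * ?D m' s))"
      by (rule trans[OF sum.cong[OF refl sum.swap] sum.swap])
    also have "\<dots> = (\<Sum>s\<in>weights l. (\<Sum>m\<in>weights l. psi l m z0 z1 * ?D m s) *
            cnj (\<Sum>m\<in>weights l. psi l m w0 w1 * ?D m s))"
      by (simp add: sum_product)
    also have "\<dots> = (\<Sum>s\<in>weights l. psi l s (cnj a * z0 + cnj b * z1) (- b * z0 + a * z1) *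
            cnj (psi l s (cnj a * w0 + cnj b * w1) (- b * w0 + a * w1)))"
      by (intro sum.cong refl) (simp only: identity)
    also have "\<dots> = (\<Sum>m\<in>weights l. psi l m z0 z1 * cnj (psi l m w0 w1))"
    proof -
      have "(cnj a * z0 + cnj b * z1) * cnj (cnj a * w0 + cnj b * w1)
          + (- b * z0 + a * z1) * cnj (- b * w0 + a * w1)
          = (a * cnj a + b * cnj b) * (z0 * cnj w0 + z1 * cnj w1)"
        by (simp add: algebra_simps)
      then show ?thesis by (simp only: psi_kernel norm1 mult_1)
    qed
    finally show ?thesis .
  qed
  \<comment> \<open>Coefficients are compared twice: in z for each fixed w, then, after conjugation,
    in w.\<close>
  have "cnj (?E m m') = (if m = m' then 1 else 0)"
  proof (rule psi_expansion_unique[OF _ m'])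
    fix w0 w1
    have "(\<Sum>m'\<in>weights l. ?E m m' * cnj (psi l m' w0 w1)) = cnj (psi l m w0 w1)"
      by (rule psi_expansion_unique[OF kernel m])
    then have "cnj (\<Sum>m'\<in>weights l. ?E m m' * cnj (psi l m' w0 w1)) = psi l m w0 w1" by simp
    then show "(\<Sum>k\<in>weights l. psi l k w0 w1 * cnj (?E m k))
        = (\<Sum>k\<in>weights l. psi l k w0 w1 * (if m = k then 1 else 0))"
      using m by (simp add: finite_weights[OF l] mult_ac if_distrib[of "\<lambda>x. _ * x"] cong: if_cong)
  qed
  then have "cnj (cnj (?E m m')) = cnj (if m = m' then 1 else 0)" by (simp only:)
  then show ?thesis by (simp only: complex_cnj_cnj if_distrib[of cnj] complex_cnj_one complex_cnj_zero)
qed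

text \<open>Let h be the adjoint of g. By unitarity of rows D(h) is D(h) D(g) times the adjoint of
  D(g), and D(h) D(g) = D(h g) is the identity.\<close>

lemma wignerD_adjoint:
  assumes m: "m \<in> weights l" and k: "k \<in> weights l" and g: "su2_mat a b \<in> SU2"
  shows "wignerD l m k (su2_mat (cnj a) (- b)) = cnj (wignerD l k m (su2_mat a b))"
proof -
  define g where "g = su2_mat a b"
  define h where "h = su2_mat (cnj a) (- b)"
  have gh: "g \<in> SU2" "h \<in> SU2" using assms(3) by (simp_all add: g_def h_def SU2_adjoint)
  have "(cmod a)\<^sup>2 + (cmod b)\<^sup>2 = 1"
    using assms(3) by (auto simp: SU2_iff su2_mat_def vec_eq_iff forall_2)
  then have "a * cnj a + b * cnj b = 1"
    by (simp only: complex_norm_square[symmetric]) (metis of_real_1 of_real_add)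
  \<comment> \<open>Writing the identity as \<open>g3 0\<close> lets \<open>wignerD_g3\<close>
    evaluate its Wigner matrix.\<close>
  then have hg: "h ** g = g3 0"
    by (simp add: h_def g_def su2_mat_mult g3_eq mult_ac)
  have "wignerD l m k h = (\<Sum>i\<in>weights l. wignerD l m i h *
      (\<Sum>j\<in>weights l. wignerD l i j g * cnj (wignerD l k j g)))"
    using k gh by (simp add: wignerD_unitary_rows l if_distrib[of "\<lambda>x. _ * x"] cong: if_cong)
  also have "\<dots> = (\<Sum>j\<in>weights l. (\<Sum>i\<in>weights l. wignerD l m i h * wignerD l i j g)
      * cnj (wignerD l k j g))"
    unfolding sum_distrib_left sum_distrib_right by (subst sum.swap) (simp add: mult.assoc)
  also have "\<dots> = (\<Sum>j\<in>weights l. wignerD l m j (h ** g) * cnj (wignerD l k j g))"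
    using m gh by (simp add: wignerD_mult)
  also have "\<dots> = cnj (wignerD l k m g)"
    using m by (simp add: hg wignerD_g3 l if_distrib[of "\<lambda>x. x * _"] cong: if_cong)
  finally show ?thesis by (simp add: g_def h_def)
qed

text \<open>The columns are the conjugated rows of the adjoint element.\<close>

lemma wignerD_unitary_columns:
  assumes s: "s \<in> weights l" and s': "s' \<in> weights l" and g: "g \<in> SU2"
  shows "(\<Sum>m\<in>weights l. wignerD l m s g * cnj (wignerD l m s' g)) = (if s = s' then 1 else 0)"
proof -
  obtain a b where ab: "g = su2_mat a b" using g by (auto simp: SU2_iff)
  show ?thesis
    using wignerD_unitary_rows[OF s' s SU2_adjoint[OF g[unfolded ab]]] s s' g
    by (auto simp: ab wignerD_adjoint mult_ac cong: sum.cong)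
qed

lemma sum_norm_wignerD_column:
  assumes "s \<in> weights l" "g \<in> SU2"
  shows "(\<Sum>m\<in>weights l. (cmod (wignerD l m s g))\<^sup>2) = 1"
proof -
  have "complex_of_real (\<Sum>m\<in>weights l. (cmod (wignerD l m s g))\<^sup>2) = 1"
    using wignerD_unitary_columns[of s s g] assms
    by (simp add: complex_norm_square flip: of_real_power)
  then show ?thesis by (simp only: of_real_eq_1_iff)
qed

lemma sum_norm_wignerD_row:
  assumes "m \<in> weights l" "g \<in> SU2"
  shows "(\<Sum>s\<in>weights l. (cmod (wignerD l m s g))\<^sup>2) = 1"
proof -
  have "complex_of_real (\<Sum>s\<in>weights l. (cmod (wignerD l m s g))\<^sup>2) = 1"
    using wignerD_unitary_rows[of m m g] assms
    by (simp add: complex_norm_square flip: of_real_power)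
  then show ?thesis by (simp only: of_real_eq_1_iff)
qed

lemma norm_wignerD_le_1:
  assumes "m \<in> weights l" "s \<in> weights l" "g \<in> SU2"
  shows "cmod (wignerD l m s g) \<le> 1"
proof -
  have "(cmod (wignerD l m s g))\<^sup>2 \<le> (\<Sum>s\<in>weights l. (cmod (wignerD l m s g))\<^sup>2)"
    using assms l by (intro member_le_sum) auto
  then show ?thesis using assms by (simp add: sum_norm_wignerD_row power_le_one_iff abs_square_le_1)
qed

end

section \<open>Orthogonality of the Wigner functions\<close>

lemma borel_measurable_cnj [measurable]:
  "f \<in> borel_measurable N \<Longrightarrow> (\<lambda>x. cnj (f x)) \<in> borel_measurable N"
  using measurable_compose[of f N borel cnj borel]
    borel_measurable_continuous_onI[OF continuous_on_cnj[OF continuous_on_id]] by auto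

text \<open>Generic in that no entry vanishes, which makes the row and column of weight l of its
  Wigner matrix free of zeros. Other entries may vanish: for l = 1 the middle one is |\<alpha>|^2 -
  |\<beta>|^2 = 0.\<close>

definition generic_rotation :: "complex^2^2" where
  "generic_rotation = su2_mat (of_real (sqrt (1 / 2))) (of_real (sqrt (1 / 2)))"

lemma generic_rotation_SU2: "generic_rotation \<in> SU2"
  unfolding generic_rotation_def SU2_iff
  by (rule exI, rule exI, rule conjI[OF refl]) simp

text \<open>Column \<open>l\<close> is a reference choice; \<open>integral_norm_wignerD\<close>
  shows that every column gives the same value.\<close>

definition wigner_mass :: "real \<Rightarrow> real \<Rightarrow> real" where
  "wigner_mass l m = (LINT g|su2_volume. (cmod (wignerD l m l g))\<^sup>2)"

lemma wigner_mass_nonneg: "0 \<le> wigner_mass l m"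
  by (simp add: wigner_mass_def)

lemma L2_norm_SU2_cong:
  "(\<And>g. g \<in> SU2 \<Longrightarrow> f g = f' g) \<Longrightarrow> L2_norm_SU2 f = L2_norm_SU2 f'"
  unfolding L2_norm_SU2_def by (intro arg_cong[of _ _ sqrt] Bochner_Integration.integral_cong) simp_all

context
  fixes l :: real
  assumes l: "2 * l \<in> \<nat>"
begin

text \<open>At the point (1, 0) every \<open>psi l m\<close> except \<open>psi l l\<close> vanishes,
  so the defining identity isolates this row.\<close>

lemma wignerD_top_row:
  assumes s: "s \<in> weights l"
  shows "wignerD l l s (su2_mat a b) = psi l s (cnj a) (- b)"
proof -
  have "psi l m 1 0 = (if m = l then 1 else 0)" if "m \<in> weights l" for m
    using that by (rule weightsE[OF l]) (auto simp: psi_def power_0_left)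
  then have "(\<Sum>m\<in>weights l. psi l m 1 0 * wignerD l m s (su2_mat a b)) = wignerD l l s (su2_mat a b)"
    by (simp add: finite_weights[OF l] top_weight[OF l] if_distrib[of "\<lambda>x. x * _"] cong: if_cong)
  then show ?thesis
    using wignerD_identity[OF l s, of a b, unfolded wigner_identity_def, rule_format, of 1 0] by simp
qed

lemma wignerD_generic_rotation_nonzero:
  assumes "m \<in> weights l"
  shows "wignerD l l m generic_rotation \<noteq> 0" "wignerD l m l generic_rotation \<noteq> 0"
proof -
  have psi: "psi l m x y \<noteq> 0" if "x \<noteq> 0" "y \<noteq> 0" for x y
    using assms by (rule weightsE[OF l]) (simp add: psi_def that)
  show "wignerD l l m generic_rotation \<noteq> 0"
    unfolding generic_rotation_def wignerD_top_row[OF assms] by (rule psi) simp_all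
  let ?r = "complex_of_real (sqrt (1 / 2))"
  \<comment> \<open>The adjoint of this element is \<open>generic_rotation\<close>, so column
    \<open>l\<close> of the latter is a conjugated top row, again without zeros.\<close>
  have "su2_mat ?r (- ?r) \<in> SU2"
    using SU2_adjoint[OF generic_rotation_SU2[unfolded generic_rotation_def]] by simp
  from wignerD_adjoint[OF l assms top_weight[OF l] this]
  have "wignerD l m l generic_rotation = cnj (psi l m (cnj ?r) (- (- ?r)))"
    unfolding generic_rotation_def wignerD_top_row[OF assms] by simp
  then show "wignerD l m l generic_rotation \<noteq> 0" using psi by simp
qed

lemma wignerD_mult_g3_mult:
  assumes "m \<in> weights l" "s \<in> weights l" "g \<in> SU2" "h \<in> SU2"
  shows "wignerD l m s (g ** (g3 t ** h))
    = (\<Sum>k\<in>weights l. wignerD l m k g * wignerD l k s h * cis (- k * t))"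
proof -
  have "wignerD l m s (g ** (g3 t ** h)) = (\<Sum>k\<in>weights l. wignerD l m k g * wignerD l k s (g3 t ** h))"
    using assms by (intro wignerD_mult[OF l]) simp_all
  also have "\<dots> = (\<Sum>k\<in>weights l. wignerD l m k g * wignerD l k s h * cis (- k * t))"
    using assms(2,4) by (intro sum.cong refl) (simp only: wignerD_mult_g3[OF l] mult_ac)
  finally show ?thesis .
qed

text \<open>If the function vanished everywhere, so would the trigonometric polynomial in t obtained
  at g (g3 t) g with g = \<open>generic_rotation\<close>. But its coefficient at weight
  \<open>l\<close> is a product of an entry in column \<open>l\<close> and an entry in row
  \<open>l\<close>, both nonzero.\<close>

lemma wignerD_nonzero:
  assumes m: "m \<in> weights l" and s: "s \<in> weights l"
  shows "\<exists>g\<in>SU2. wignerD l m s g \<noteq> 0"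
proof (rule ccontr)
  assume zero: "\<not> ?thesis"
  let ?g = generic_rotation and ?N = "card (weights l)"
  have "wignerD l m s (?g ** (g3 t ** ?g)) = 0" for t
    using zero by (auto simp: generic_rotation_SU2)
  then have "(\<Sum>k\<in>weights l. wignerD l m k ?g * wignerD l k s ?g * cis (- k * t)) = 0" for t
    using m s by (simp only: wignerD_mult_g3_mult[OF _ _ generic_rotation_SU2 generic_rotation_SU2])
  then have "of_nat ?N * (wignerD l m l ?g * wignerD l l s ?g) = 0"
    using dft_coefficient[OF l top_weight[OF l], of "\<lambda>k. wignerD l m k ?g * wignerD l k s ?g"]
    by (simp only: mult_zero_right sum.neutral_const)
  then show False
    using m s by (simp add: wignerD_generic_rotation_nonzero card_weights[OF l] del: of_nat_Suc)
qed

text \<open>The definition by \<open>THE\<close> gives no access to regularity. Inverting the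
  defining identity with \<open>psi_dft\<close> yields an explicit polynomial in the first column of
  g and its conjugate, which is continuous on all matrices.\<close>

lemma borel_measurable_wignerD:
  assumes m: "m \<in> weights l" and s: "s \<in> weights l"
  shows "wignerD l m s \<in> borel_measurable su2_borel"
proof -
  let ?N = "card (weights l)"
  let ?F = "\<lambda>g::complex^2^2. (\<Sum>j<?N. cis (- (l + m) * node l j) *
      psi l s (cnj (g$1$1) * cis (node l j) + cnj (g$2$1) * 1) (- (g$2$1) * cis (node l j) + g$1$1 * 1))
      / (of_nat ?N * psi l m 1 1)"
  have column: "wignerD l m s g = wignerD l m s (su2_mat (g$1$1) (g$2$1))" for m g
    by (simp add: wignerD_def su2_mat_def)
  have "wignerD l m s g = ?F g" for g
  proof -
    have "of_nat ?N * psi l m 1 1 * wignerD l m s g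
        = (\<Sum>j<?N. cis (- (l + m) * node l j) *
      psi l s (cnj (g$1$1) * cis (node l j) + cnj (g$2$1) * 1) (- (g$2$1) * cis (node l j) + g$1$1 * 1))"
      using psi_dft[OF l m, of "\<lambda>m. wignerD l m s g"]
        wignerD_identity[OF l s, of "g$1$1" "g$2$1", folded column]
      by (simp only: wigner_identity_def)
    moreover have "of_nat ?N * psi l m 1 1 \<noteq> 0"
      using psi_1_1_nonzero[OF l m] by (simp add: card_weights[OF l] del: of_nat_Suc)
    ultimately show ?thesis by (simp add: eq_divide_eq mult_ac)
  qed
  moreover have "continuous_on UNIV ?F"
    unfolding psi_def divide_inverse by (intro continuous_intros)
  ultimately have "continuous_on UNIV (wignerD l m s)" by (simp add: fun_eq_iff cong: continuous_on_cong)
  then show ?thesis by (intro measurable_restrict_space1 borel_measurable_continuous_onI)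
qed

section \<open>Inner products and norms of Wigner functions\<close>

lemma integrable_wignerD_mult:
  assumes "m \<in> weights l" "s \<in> weights l" "m' \<in> weights l" "s' \<in> weights l"
  shows "integrable su2_volume (\<lambda>g. wignerD l m s g * cnj (wignerD l m' s' g))"
proof -
  interpret finite_measure su2_volume by (rule finite_measure_su2_volume)
  note [measurable] = borel_measurable_wignerD
  show ?thesis
  proof (rule integrable_const_bound[of _ 1])
    show "AE g in su2_volume. norm (wignerD l m s g * cnj (wignerD l m' s' g)) \<le> 1"
      using assms by (intro AE_I2) (auto simp: norm_mult intro!: mult_le_one norm_wignerD_le_1[OF l])
    show "(\<lambda>g. wignerD l m s g * cnj (wignerD l m' s' g)) \<in> borel_measurable su2_volume"
      using assms by measurable
  qed
qed

text \<open>Translation by \<open>g3 t\<close> from the right or left leaves the integral unchanged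
  but multiplies the integrand by a phase of frequency s' - s or m' - m. One of the two frequencies
  is nonzero.\<close>

lemma wignerD_orthogonal:
  assumes "m \<in> weights l" "s \<in> weights l" "m' \<in> weights l" "s' \<in> weights l"
    and ne: "(m, s) \<noteq> (m', s')"
  shows "(LINT g|su2_volume. wignerD l m s g * cnj (wignerD l m' s' g)) = 0" (is "?I = 0")
proof -
  let ?F = "\<lambda>g. wignerD l m s g * cnj (wignerD l m' s' g)"
  have F: "?F \<in> borel_measurable su2_borel"
    using assms borel_measurable_wignerD by measurable
  have right: "?I = cis ((s' - s) * t) * ?I" for t
  proof -
    have cis: "cis (- s * t) * cnj (cis (- s' * t)) = cis ((s' - s) * t)"
      by (simp add: cis_cnj cis_mult algebra_simps)
    have F_shift: "?F (g ** g3 t) = cis ((s' - s) * t) * ?F g" if "g \<in> SU2" for g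
      unfolding cis[symmetric] using assms that by (simp add: wignerD_mult_g3[OF l] mult_ac)
    have "?I = (LINT g|su2_volume. ?F (g ** g3 t))"
      by (rule integral_su2_volume_mult(2)[symmetric, OF g3_SU2 F])
    also have "\<dots> = (LINT g|su2_volume. cis ((s' - s) * t) * ?F g)"
      by (intro Bochner_Integration.integral_cong refl F_shift) simp
    finally show ?thesis by simp
  qed
  have left: "?I = cis ((m' - m) * t) * ?I" for t
  proof -
    have cis: "cis (- m * t) * cnj (cis (- m' * t)) = cis ((m' - m) * t)"
      by (simp add: cis_cnj cis_mult algebra_simps)
    have F_shift: "?F (g3 t ** g) = cis ((m' - m) * t) * ?F g" if "g \<in> SU2" for g
      unfolding cis[symmetric] using assms that by (simp add: wignerD_mult_g3[OF l] mult_ac)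
    have "?I = (LINT g|su2_volume. ?F (g3 t ** g))"
      by (rule integral_su2_volume_mult(1)[symmetric, OF g3_SU2 F])
    also have "\<dots> = (LINT g|su2_volume. cis ((m' - m) * t) * ?F g)"
      by (intro Bochner_Integration.integral_cong refl F_shift) simp
    finally show ?thesis by simp
  qed
  show ?thesis
  proof (cases "m = m'")
    case True
    then show ?thesis using ne by (intro eq_0_if_cis_mult[OF right]) auto
  next
    case False
    then show ?thesis by (intro eq_0_if_cis_mult[OF left]) auto
  qed
qed

lemma integrable_norm_wignerD:
  assumes "m \<in> weights l" "s \<in> weights l"
  shows "integrable su2_volume (\<lambda>g. (cmod (wignerD l m s g))\<^sup>2)"
  using integrable_norm[OF integrable_wignerD_mult[OF assms assms]]
  by (simp add: norm_mult power2_eq_square)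

text \<open>Averaging the right translates by \<open>g3 t ** generic_rotation\<close> expresses the squared norms of
  one row of the Wigner matrix as a fixed point of a stochastic matrix with a positive column.\<close>
lemma integral_norm_wignerD:
  assumes m: "m \<in> weights l" and s: "s \<in> weights l"
  shows "(LINT g|su2_volume. (cmod (wignerD l m s g))\<^sup>2) = wigner_mass l m"
proof -
  let ?N = "card (weights l)" and ?h = generic_rotation
  define f where "f s = (LINT g|su2_volume. (cmod (wignerD l m s g))\<^sup>2)" for s
  \<comment> \<open>Rows of \<open>p\<close> are columns of the Wigner matrix, hence sum to 1; its
    positive column \<open>l\<close> is the top row of the Wigner matrix.\<close>
  define p where "p s k = (cmod (wignerD l k s ?h))\<^sup>2" for s k
  have fixed: "f s = (\<Sum>k\<in>weights l. p s k * f k)" if s: "s \<in> weights l" for s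
  proof -
    let ?F = "\<lambda>g. (cmod (wignerD l m s g))\<^sup>2"
    have F: "?F \<in> borel_measurable su2_borel"
      using m s borel_measurable_wignerD by measurable
    have hj: "g3 (node l j) ** ?h \<in> SU2" for j by (simp add: generic_rotation_SU2)
    have "real ?N * f s = (\<Sum>j<?N. f s)" by (simp only: sum_constant card_lessThan)
    also have "\<dots> = (\<Sum>j<?N. LINT g|su2_volume. ?F (g ** (g3 (node l j) ** ?h)))"
      unfolding f_def by (intro sum.cong refl integral_su2_volume_mult(2)[symmetric, OF hj F])
    also have "\<dots> = (LINT g|su2_volume. (\<Sum>j<?N. ?F (g ** (g3 (node l j) ** ?h))))"
    proof (rule Bochner_Integration.integral_sum[symmetric])
      fix j
      show "integrable su2_volume (\<lambda>g. ?F (g ** (g3 (node l j) ** ?h)))"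
      proof (rule integrable_distr[of "\<lambda>g. g ** (g3 (node l j) ** ?h)" su2_volume su2_borel ?F])
        show "(\<lambda>g. g ** (g3 (node l j) ** ?h)) \<in> measurable su2_volume su2_borel"
          unfolding measurable_cong_sets[OF sets_su2_volume refl]
          by (rule measurable_matrix_mult_SU2(2)[OF hj])
        show "integrable (distr su2_volume su2_borel (\<lambda>g. g ** (g3 (node l j) ** ?h))) ?F"
          unfolding distr_su2_volume_mult(2)[OF hj] by (rule integrable_norm_wignerD[OF m s])
      qed
    qed
    also have "\<dots> = (LINT g|su2_volume. real ?N * (\<Sum>k\<in>weights l. p s k * (cmod (wignerD l m k g))\<^sup>2))"
    proof (intro Bochner_Integration.integral_cong refl)
      fix g assume "g \<in> space su2_volume"
      then have "g \<in> SU2" by simp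
      show "(\<Sum>j<?N. ?F (g ** (g3 (node l j) ** ?h)))
          = real ?N * (\<Sum>k\<in>weights l. p s k * (cmod (wignerD l m k g))\<^sup>2)"
        unfolding wignerD_mult_g3_mult[OF m s \<open>g \<in> SU2\<close> generic_rotation_SU2] dft_parseval[OF l] p_def
        by (simp only: norm_mult power_mult_distrib mult_ac)
    qed
    also have "\<dots> = real ?N * (LINT g|su2_volume. (\<Sum>k\<in>weights l. p s k * (cmod (wignerD l m k g))\<^sup>2))"
      by (rule integral_mult_right_zero)
    also have "(LINT g|su2_volume. (\<Sum>k\<in>weights l. p s k * (cmod (wignerD l m k g))\<^sup>2))
        = (\<Sum>k\<in>weights l. LINT g|su2_volume. p s k * (cmod (wignerD l m k g))\<^sup>2)"
      by (intro Bochner_Integration.integral_sum integrable_mult_right integrable_norm_wignerD m)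
    also have "\<dots> = (\<Sum>k\<in>weights l. p s k * f k)"
      unfolding f_def by (intro sum.cong refl integral_mult_right_zero)
    finally show ?thesis by (simp add: card_weights[OF l] del: of_nat_Suc)
  qed
  have "f s = f l"
  proof (rule constant_if_stochastic_fixed_point[of "weights l" p l f s])
    show "(\<Sum>k\<in>weights l. p s k) = 1" if "s \<in> weights l" for s
      unfolding p_def by (rule sum_norm_wignerD_column[OF l that generic_rotation_SU2])
    show "0 < p s l" if "s \<in> weights l" for s
      unfolding p_def using wignerD_generic_rotation_nonzero[OF that] by simp
  qed (simp_all only: s fixed finite_weights[OF l] top_weight[OF l], simp add: p_def)
  then show ?thesis by (simp only: f_def wigner_mass_def)
qed

text \<open>Orthogonality leaves the diagonal terms, and their weight depends on m only. That shape
  makes the norm compatible with unitary mixing inside each row.\<close>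

lemma L2_norm_phi_expansion:
  "(L2_norm_SU2 (\<lambda>g. \<Sum>m\<in>weights l. \<Sum>s\<in>weights l. c m s * phi l m s g))\<^sup>2
    = (2 * l + 1) / (4 * pi)\<^sup>2 * (\<Sum>m\<in>weights l. \<Sum>s\<in>weights l. wigner_mass l m * (cmod (c m s))\<^sup>2)"
proof -
  let ?P = "weights l \<times> weights l"
  define \<kappa> where "\<kappa> = sqrt (2 * l + 1) / (4 * pi)"
  define D where "D p = wignerD l (fst p) (snd p)" for p
  define C where "C p = c (fst p) (snd p) * complex_of_real \<kappa>" for p
  let ?f = "\<lambda>g. \<Sum>m\<in>weights l. \<Sum>s\<in>weights l. c m s * phi l m s g"
  have fin: "finite ?P" by (simp add: finite_weights[OF l])
  have f: "?f g = (\<Sum>p\<in>?P. C p * D p g)" for g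
    unfolding sum.cartesian_product
    by (rule sum.cong[OF refl]) (clarsimp simp: C_def D_def \<kappa>_def phi_def)
  have int: "integrable su2_volume (\<lambda>g. D p g * cnj (D q g))" if "p \<in> ?P" "q \<in> ?P" for p q
    using that unfolding D_def by (intro integrable_wignerD_mult) auto
  have I: "(LINT g|su2_volume. D p g * cnj (D q g)) = (if p = q then of_real (wigner_mass l (fst p)) else 0)"
    if "p \<in> ?P" "q \<in> ?P" for p q
  proof (cases "p = q")
    case True
    have "(LINT g|su2_volume. D p g * cnj (D p g)) = of_real (LINT g|su2_volume. (cmod (D p g))\<^sup>2)"
      by (simp only: complex_norm_square flip: integral_complex_of_real)
    also have "(LINT g|su2_volume. (cmod (D p g))\<^sup>2) = wigner_mass l (fst p)"
      using that unfolding D_def by (intro integral_norm_wignerD) auto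
    finally show ?thesis using True by simp
  next
    case False
    then show ?thesis using that unfolding D_def
      by (auto simp: prod_eq_iff intro!: wignerD_orthogonal)
  qed
  have "complex_of_real ((L2_norm_SU2 ?f)\<^sup>2) = complex_of_real (LINT g|su2_volume. (cmod (?f g))\<^sup>2)"
    unfolding L2_norm_SU2_def by simp
  also have "\<dots> = (LINT g|su2_volume. ?f g * cnj (?f g))"
    unfolding integral_complex_of_real[symmetric] by (simp only: complex_norm_square)
  also have "\<dots> = (LINT g|su2_volume. (\<Sum>p\<in>?P. \<Sum>q\<in>?P. C p * cnj (C q) * (D p g * cnj (D q g))))"
    unfolding f cnj_sum sum_product by (simp only: complex_cnj_mult mult_ac)
  also have "\<dots> = (\<Sum>p\<in>?P. LINT g|su2_volume. (\<Sum>q\<in>?P. C p * cnj (C q) * (D p g * cnj (D q g))))"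
    by (rule Bochner_Integration.integral_sum)
      (intro Bochner_Integration.integrable_sum integrable_mult_right int)
  also have "\<dots> = (\<Sum>p\<in>?P. \<Sum>q\<in>?P. LINT g|su2_volume. C p * cnj (C q) * (D p g * cnj (D q g)))"
    by (intro sum.cong refl Bochner_Integration.integral_sum integrable_mult_right int)
  also have "\<dots> = (\<Sum>p\<in>?P. C p * cnj (C p) * of_real (wigner_mass l (fst p)))"
  proof (rule sum.cong[OF refl])
    fix p assume p: "p \<in> ?P"
    have "(\<Sum>q\<in>?P. LINT g|su2_volume. C p * cnj (C q) * (D p g * cnj (D q g)))
        = (\<Sum>q\<in>?P. if p = q then C p * cnj (C p) * of_real (wigner_mass l (fst p)) else 0)"
    proof (rule sum.cong[OF refl])
      fix q assume "q \<in> ?P"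
      with p show "(LINT g|su2_volume. C p * cnj (C q) * (D p g * cnj (D q g)))
          = (if p = q then C p * cnj (C p) * of_real (wigner_mass l (fst p)) else 0)"
        by (simp only: integral_mult_right_zero I) simp
    qed
    also have "\<dots> = C p * cnj (C p) * of_real (wigner_mass l (fst p))"
      using p by (simp only: sum.delta'[OF fin] if_True)
    finally show "(\<Sum>q\<in>?P. LINT g|su2_volume. C p * cnj (C q) * (D p g * cnj (D q g)))
        = C p * cnj (C p) * of_real (wigner_mass l (fst p))" .
  qed
  also have "\<dots> = complex_of_real (\<Sum>p\<in>?P. (cmod (C p))\<^sup>2 * wigner_mass l (fst p))"
    unfolding complex_norm_square[symmetric] by simp
  also have "(\<Sum>p\<in>?P. (cmod (C p))\<^sup>2 * wigner_mass l (fst p))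
      = \<kappa>\<^sup>2 * (\<Sum>m\<in>weights l. \<Sum>s\<in>weights l. wigner_mass l m * (cmod (c m s))\<^sup>2)"
    unfolding sum.cartesian_product sum_distrib_left
    by (rule sum.cong[OF refl]) (clarsimp simp: C_def norm_mult power_mult_distrib)
  also have "\<kappa>\<^sup>2 = (2 * l + 1) / (4 * pi)\<^sup>2"
    using weights_nonneg[OF l] by (simp add: \<kappa>_def power_divide)
  finally show ?thesis by (simp only: of_real_eq_iff)
qed

lemma L2_norm_spin_component:
  assumes "s \<in> weights l"
  shows "(L2_norm_SU2 (spin_component l a s \<omega>))\<^sup>2
    = (2 * l + 1) / (4 * pi)\<^sup>2 * (\<Sum>m\<in>weights l. wigner_mass l m * (cmod (a m s \<omega>))\<^sup>2)"
proof -
  have "spin_component l a s \<omega> = (\<lambda>g. \<Sum>m\<in>weights l. \<Sum>s'\<in>weights l.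
      (if s' = s then a m s \<omega> else 0) * phi l m s' g)"
    using assms by (simp add: spin_component_def finite_weights[OF l] fun_eq_iff
        if_distrib[of "\<lambda>x. x * _"] cong: if_cong)
  then show ?thesis
    using assms by (simp add: L2_norm_phi_expansion finite_weights[OF l] if_distrib[of cmod]
        if_distrib[of "\<lambda>x. x ^ _"] if_distrib[of "\<lambda>x. _ * x"] cong: if_cong)
qed

end

section \<open>Coefficients of bi-invariant fields\<close>

lemma measurable_random_field_at:
  assumes "random_field M X" "g \<in> SU2"
  shows "(\<lambda>\<omega>. X \<omega> g) \<in> borel_measurable M"
proof -
  have "(\<lambda>\<omega>. (\<omega>, g)) \<in> measurable M (M \<Otimes>\<^sub>M su2_borel)"
    using assms(2) by (intro measurable_Pair measurable_ident measurable_const)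
      (simp_all add: space_restrict_space)
  from measurable_compose[OF this assms(1)[unfolded random_field_def]]
  show ?thesis by simp
qed

lemma integral_law_right_mult:
  fixes \<Phi> :: "(complex^2^2 \<Rightarrow> complex) \<Rightarrow> 'b::{banach, second_countable_topology}"
  assumes X: "random_field M X" and inv: "bi_invariant M X" and h: "h \<in> SU2"
    and \<Phi>: "\<Phi> \<in> borel_measurable (\<Pi>\<^sub>M g\<in>SU2. borel)"
  shows "(LINT \<omega>|M. \<Phi> (\<lambda>g\<in>SU2. X \<omega> (g ** h))) = (LINT \<omega>|M. \<Phi> (\<lambda>g\<in>SU2. X \<omega> g))"
proof -
  \<comment> \<open>With the identity as left factor, \<open>bi_invariant\<close> speaks of right
    translation by \<open>h\<close>.\<close>
  have law: "field_law M (\<lambda>\<omega> g. X \<omega> (g ** h)) = field_law M X"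
    using inv[unfolded bi_invariant_def, rule_format, OF mat_1_SU2 h]
    by (simp only: matrix_inv_mat_1 matrix_mul_lid)
  have meas: "(\<lambda>\<omega>. \<lambda>g\<in>SU2. X \<omega> (g ** k)) \<in> measurable M (\<Pi>\<^sub>M g\<in>SU2. borel)" if "k \<in> SU2" for k
    using measurable_random_field_at[OF X] that by (intro measurable_restrict) simp
  have "(LINT \<omega>|M. \<Phi> (\<lambda>g\<in>SU2. X \<omega> (g ** h))) = (LINT F|field_law M (\<lambda>\<omega> g. X \<omega> (g ** h)). \<Phi> F)"
    unfolding field_law_def by (rule integral_distr[symmetric, OF meas[OF h] \<Phi>])
  also have "\<dots> = (LINT \<omega>|M. \<Phi> (\<lambda>g\<in>SU2. X \<omega> g))"
    unfolding law unfolding field_law_def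
    using meas[OF mat_1_SU2] by (intro integral_distr \<Phi>) simp
  finally show ?thesis .
qed

section \<open>Reading coefficients off finitely many field values\<close>

definition phi_pivot :: "real \<Rightarrow> real \<Rightarrow> real \<Rightarrow> complex^2^2" where
  "phi_pivot l m s = (SOME g. g \<in> SU2 \<and> wignerD l m s g \<noteq> 0)"

text \<open>Coefficients are read off from finitely many field values, because the law of a field lives
  on the product \<open>\<sigma>\<close>-algebra, for which the Fourier integrals over \<open>SU2\<close> are not measurable.\<close>
definition field_coeff :: "real \<Rightarrow> real \<Rightarrow> real \<Rightarrow> (complex^2^2 \<Rightarrow> complex) \<Rightarrow> complex" where
  "field_coeff l m s F =
    (\<Sum>i<card (weights l). cis (m * node l i) * (\<Sum>j<card (weights l). cis (s * node l j) *
      F (g3 (node l i) ** (phi_pivot l m s ** g3 (node l j)))))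
    / (of_nat (card (weights l)) * (of_nat (card (weights l)) * phi l m s (phi_pivot l m s)))"

context
  fixes l :: real
  assumes l: "2 * l \<in> \<nat>"
begin

lemma phi_pivot:
  assumes "m \<in> weights l" "s \<in> weights l"
  shows "phi_pivot l m s \<in> SU2" "phi l m s (phi_pivot l m s) \<noteq> 0"
proof -
  have *: "phi_pivot l m s \<in> SU2 \<and> wignerD l m s (phi_pivot l m s) \<noteq> 0"
    unfolding phi_pivot_def using wignerD_nonzero[OF l assms, unfolded Bex_def] by (rule someI_ex)
  then show "phi_pivot l m s \<in> SU2" by simp
  have "2 * l + 1 \<noteq> 0" using weights_nonneg[OF l] by linarith
  then have "sqrt (2 * l + 1) / (4 * pi) \<noteq> 0" by simp
  then show "phi l m s (phi_pivot l m s) \<noteq> 0"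
    unfolding phi_def using * by (simp only: mult_eq_0_iff of_real_eq_0_iff simp_thms)
qed

lemma phi_mult:
  assumes "m \<in> weights l" "s \<in> weights l" "g \<in> SU2" "h \<in> SU2"
  shows "phi l m s (g ** h) = (\<Sum>k\<in>weights l. phi l m k g * wignerD l k s h)"
  using assms unfolding phi_def by (simp only: wignerD_mult[OF l] sum_distrib_left mult.assoc)

lemma phi_mult_g3:
  assumes "m \<in> weights l" "s \<in> weights l" "g \<in> SU2"
  shows "phi l m s (g ** g3 t) = phi l m s g * cis (- s * t)"
    and "phi l m s (g3 t ** g) = cis (- m * t) * phi l m s g"
  using assms unfolding phi_def by (simp_all only: wignerD_mult_g3[OF l] mult_ac)

lemma borel_measurable_phi:
  "m \<in> weights l \<Longrightarrow> s \<in> weights l \<Longrightarrow> phi l m s \<in> borel_measurable su2_borel"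
  unfolding phi_def[abs_def] by (intro borel_measurable_times borel_measurable_const borel_measurable_wignerD l)

text \<open>At g3 t, pivot, g3 t' multiplied in this order, the term with indices k, k' carries the
  phase cis (- k t) cis (- k' t'). A discrete Fourier transform on each side isolates k = m and k' =
  s; the value of \<open>phi l m s\<close> at the pivot is then divided out.\<close>

lemma field_coeff_expansion:
  assumes F: "\<And>g. g \<in> SU2 \<Longrightarrow> F g = (\<Sum>m\<in>weights l. \<Sum>s\<in>weights l. c m s * phi l m s g)"
    and m: "m \<in> weights l" and s: "s \<in> weights l"
  shows "field_coeff l m s F = c m s"
proof -
  let ?N = "card (weights l)" and ?w = "phi_pivot l m s"
  note w = phi_pivot[OF m s]
  define A where "A k k' = c k k' * phi l k k' ?w" for k k'
  have eval_at: "F (g3 t ** (?w ** g3 t'))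
      = (\<Sum>k\<in>weights l. (\<Sum>k'\<in>weights l. A k k' * cis (- k' * t')) * cis (- k * t))" for t t'
  proof -
    have "F (g3 t ** (?w ** g3 t')) = (\<Sum>k\<in>weights l. \<Sum>k'\<in>weights l. c k k' * phi l k k' (g3 t ** (?w ** g3 t')))"
      using w(1) by (intro F) simp
    also have "\<dots> = (\<Sum>k\<in>weights l. (\<Sum>k'\<in>weights l. A k k' * cis (- k' * t')) * cis (- k * t))"
      unfolding sum_distrib_right
    proof (intro sum.cong refl)
      fix k k' assume k: "k \<in> weights l" "k' \<in> weights l"
      have "?w ** g3 t' \<in> SU2" using w(1) by simp
      then show "c k k' * phi l k k' (g3 t ** (?w ** g3 t')) = A k k' * cis (- k' * t') * cis (- k * t)"
        unfolding A_def by (simp only: phi_mult_g3 k w(1) mult_ac)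
    qed
    finally show ?thesis .
  qed
  have inner: "(\<Sum>j<?N. cis (s * node l j) * F (g3 t ** (?w ** g3 (node l j))))
      = (\<Sum>k\<in>weights l. of_nat ?N * A k s * cis (- k * t))" for t
  proof -
    have "(\<Sum>j<?N. cis (s * node l j) * F (g3 t ** (?w ** g3 (node l j))))
        = (\<Sum>k\<in>weights l. (\<Sum>j<?N. cis (s * node l j) *
            (\<Sum>k'\<in>weights l. A k k' * cis (- k' * node l j))) * cis (- k * t))"
      unfolding eval_at sum_distrib_right sum_distrib_left[of "cis (s * node l _)"]
      by (subst sum.swap) (simp only: sum_distrib_left sum_distrib_right mult.assoc)
    then show ?thesis by (simp only: dft_coefficient[OF l s])
  qed
  have "(\<Sum>i<?N. cis (m * node l i) * (\<Sum>j<?N. cis (s * node l j) *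
      F (g3 (node l i) ** (?w ** g3 (node l j)))))
    = of_nat ?N * (of_nat ?N * A m s)"
    unfolding inner by (rule dft_coefficient[OF l m])
  moreover have "?N \<noteq> 0" by (simp add: card_weights[OF l])
  ultimately show ?thesis
    unfolding field_coeff_def using w(2) by (simp add: A_def)
qed

lemma borel_measurable_field_coeff:
  assumes "m \<in> weights l" "s \<in> weights l"
  shows "field_coeff l m s \<in> borel_measurable (\<Pi>\<^sub>M g\<in>SU2. borel)"
proof -
  have "(\<lambda>F. F (g3 t ** (phi_pivot l m s ** g3 t'))) \<in> borel_measurable (\<Pi>\<^sub>M g\<in>SU2. borel)" for t t'
    using phi_pivot(1)[OF assms] by (intro measurable_component_singleton) simp
  then show ?thesis unfolding field_coeff_def[abs_def] divide_inverse
    by (intro borel_measurable_times borel_measurable_sum borel_measurable_const)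
qed

lemma expansion_right_mult:
  assumes F: "\<And>g. g \<in> SU2 \<Longrightarrow> F g = (\<Sum>m\<in>weights l. \<Sum>s\<in>weights l. c m s * phi l m s g)"
    and g: "g \<in> SU2" and h: "h \<in> SU2"
  shows "F (g ** h) = (\<Sum>m\<in>weights l. \<Sum>k\<in>weights l.
    (\<Sum>s\<in>weights l. c m s * wignerD l k s h) * phi l m k g)"
proof -
  have "F (g ** h) = (\<Sum>m\<in>weights l. \<Sum>s\<in>weights l. c m s * phi l m s (g ** h))"
    using g h by (intro F) simp
  also have "\<dots> = (\<Sum>m\<in>weights l. \<Sum>s\<in>weights l. \<Sum>k\<in>weights l. c m s * wignerD l k s h * phi l m k g)"
    using g h by (intro sum.cong refl) (simp only: phi_mult sum_distrib_left mult_ac)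
  also have "\<dots> = (\<Sum>m\<in>weights l. \<Sum>k\<in>weights l. (\<Sum>s\<in>weights l. c m s * wignerD l k s h) * phi l m k g)"
    unfolding sum_distrib_right by (intro sum.cong[OF refl] sum.swap)
  finally show ?thesis .
qed

text \<open>Carries invariance in law from the field to its coefficients. Composed with
  \<open>field_coeff\<close>, the functional \<open>\<Psi>\<close> becomes a measurable function of
  the field, so its expectation is determined by the law. Since \<open>field_coeff\<close> recovers
  coefficients at weights only, \<open>\<Psi>\<close> must depend on nothing else; its measurability
  is asked on the product space for the law and on \<open>M\<close> for the almost sure
  identification.\<close>

lemma integral_coefficients_right_mult:
  fixes \<Psi> :: "(real \<Rightarrow> real \<Rightarrow> complex) \<Rightarrow> 'b::{banach, second_countable_topology}"
  assumes X: "random_field M X" and inv: "bi_invariant M X" and h: "h \<in> SU2"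
    and a: "\<And>m s. m \<in> weights l \<Longrightarrow> s \<in> weights l \<Longrightarrow> a m s \<in> borel_measurable M"
    and expansion: "AE \<omega> in M. \<forall>g\<in>SU2. X \<omega> g = (\<Sum>m\<in>weights l. \<Sum>s\<in>weights l. a m s \<omega> * phi l m s g)"
    and cong: "\<And>c c'. (\<And>m s. m \<in> weights l \<Longrightarrow> s \<in> weights l \<Longrightarrow> c m s = c' m s) \<Longrightarrow> \<Psi> c = \<Psi> c'"
    and meas_M: "\<And>b. (\<And>m s. m \<in> weights l \<Longrightarrow> s \<in> weights l \<Longrightarrow> b m s \<in> borel_measurable M) \<Longrightarrow>
        (\<lambda>\<omega>. \<Psi> (\<lambda>m s. b m s \<omega>)) \<in> borel_measurable M"
    and meas_law: "\<And>b. (\<And>m s. m \<in> weights l \<Longrightarrow> s \<in> weights l \<Longrightarrow>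
          b m s \<in> borel_measurable (\<Pi>\<^sub>M g\<in>SU2. (borel :: complex measure))) \<Longrightarrow>
        (\<lambda>F. \<Psi> (\<lambda>m s. b m s F)) \<in> borel_measurable (\<Pi>\<^sub>M g\<in>SU2. borel)"
  shows "(LINT \<omega>|M. \<Psi> (\<lambda>m k. \<Sum>s\<in>weights l. a m s \<omega> * wignerD l k s h)) = (LINT \<omega>|M. \<Psi> (\<lambda>m s. a m s \<omega>))"
proof -
  define \<Phi> where "\<Phi> F = \<Psi> (\<lambda>m s. field_coeff l m s F)" for F
  have \<Phi>: "\<Phi> \<in> borel_measurable (\<Pi>\<^sub>M g\<in>SU2. borel)"
    unfolding \<Phi>_def[abs_def] by (rule meas_law[of "field_coeff l", OF borel_measurable_field_coeff])
  have meas: "(\<lambda>\<omega>. \<Phi> (\<lambda>g\<in>SU2. X \<omega> (g ** k))) \<in> borel_measurable M" if "k \<in> SU2" for k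
    using measurable_random_field_at[OF X] that
    by (intro measurable_compose[OF measurable_restrict \<Phi>]) simp
  have eval: "\<Phi> (\<lambda>g\<in>SU2. X \<omega> (g ** k)) = \<Psi> (\<lambda>m k'. \<Sum>s\<in>weights l. a m s \<omega> * wignerD l k' s k)"
    if "\<forall>g\<in>SU2. X \<omega> g = (\<Sum>m\<in>weights l. \<Sum>s\<in>weights l. a m s \<omega> * phi l m s g)" "k \<in> SU2" for \<omega> k
    unfolding \<Phi>_def
  proof (rule cong, rule field_coeff_expansion)
    fix g :: "complex^2^2" assume "g \<in> SU2"
    then show "(\<lambda>g\<in>SU2. X \<omega> (g ** k)) g = (\<Sum>m\<in>weights l. \<Sum>k'\<in>weights l.
        (\<Sum>s\<in>weights l. a m s \<omega> * wignerD l k' s k) * phi l m k' g)"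
      using that by (simp only: restrict_apply' expansion_right_mult[of "X \<omega>" "\<lambda>m s. a m s \<omega>"] simp_thms)
  qed
  \<comment> \<open>The untranslated side is the case \<open>g3 0\<close>, the identity, so
    \<open>transfer\<close> below handles both sides.\<close>
  have one: "\<Psi> (\<lambda>m k. \<Sum>s\<in>weights l. a m s \<omega> * wignerD l k s (g3 0)) = \<Psi> (\<lambda>m s. a m s \<omega>)" for \<omega>
    by (rule cong) (simp add: wignerD_g3[OF l] finite_weights[OF l] if_distrib[of "\<lambda>x. _ * x"] cong: if_cong)
  have g30: "g3 0 = mat 1" by (simp add: g3_eq mat_1_eq)
  have transfer: "(LINT \<omega>|M. \<Psi> (\<lambda>m k'. \<Sum>s\<in>weights l. a m s \<omega> * wignerD l k' s k))
      = (LINT \<omega>|M. \<Phi> (\<lambda>g\<in>SU2. X \<omega> (g ** k)))" if k: "k \<in> SU2" for k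
  proof (rule integral_cong_AE)
    show "(\<lambda>\<omega>. \<Psi> (\<lambda>m k'. \<Sum>s\<in>weights l. a m s \<omega> * wignerD l k' s k)) \<in> borel_measurable M"
      by (intro meas_M borel_measurable_sum borel_measurable_times borel_measurable_const a)
    show "AE \<omega> in M. \<Psi> (\<lambda>m k'. \<Sum>s\<in>weights l. a m s \<omega> * wignerD l k' s k) = \<Phi> (\<lambda>g\<in>SU2. X \<omega> (g ** k))"
      using expansion by eventually_elim (rule eval[symmetric, OF _ k])
  qed (rule meas[OF k])
  show ?thesis
    using transfer[OF h] transfer[OF g3_SU2[of 0]] integral_law_right_mult[OF X inv h \<Phi>]
    by (simp only: one) (simp only: g30 matrix_mul_rid)
qed

lemma wignerD_isometry:
  assumes "h \<in> SU2"
  shows "(\<Sum>k\<in>weights l. (cmod (\<Sum>s\<in>weights l. c s * wignerD l k s h))\<^sup>2) = (\<Sum>s\<in>weights l. (cmod (c s))\<^sup>2)"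
proof -
  have "complex_of_real (\<Sum>k\<in>weights l. (cmod (\<Sum>s\<in>weights l. c s * wignerD l k s h))\<^sup>2)
      = (\<Sum>k\<in>weights l. \<Sum>s\<in>weights l. \<Sum>s'\<in>weights l.
          c s * cnj (c s') * (wignerD l k s h * cnj (wignerD l k s' h)))"
    unfolding of_real_sum complex_norm_square cnj_sum sum_product by (simp only: complex_cnj_mult mult_ac)
  also have "\<dots> = (\<Sum>s\<in>weights l. \<Sum>s'\<in>weights l. \<Sum>k\<in>weights l.
          c s * cnj (c s') * (wignerD l k s h * cnj (wignerD l k s' h)))"
    by (rule trans[OF sum.swap sum.cong[OF refl sum.swap]])
  also have "\<dots> = (\<Sum>s\<in>weights l. \<Sum>s'\<in>weights l. c s * cnj (c s') * (if s = s' then 1 else 0))"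
    unfolding sum_distrib_left[symmetric]
    by (intro sum.cong refl) (simp only: wignerD_unitary_columns[OF l _ _ assms])
  also have "\<dots> = (\<Sum>s\<in>weights l. c s * cnj (c s))"
    by (simp add: finite_weights[OF l] if_distrib[of "\<lambda>x. _ * x"] cong: if_cong)
  also have "\<dots> = complex_of_real (\<Sum>s\<in>weights l. (cmod (c s))\<^sup>2)"
    unfolding complex_norm_square[symmetric] by simp
  finally show ?thesis by (simp only: of_real_eq_iff)
qed

end

section \<open>Spin components\<close>

lemma random_spin_weighted_spin_component:
  assumes l: "2 * l \<in> \<nat>" and s: "s \<in> weights l"
    and a: "\<And>m. m \<in> weights l \<Longrightarrow> a m s \<in> borel_measurable M"
  shows "random_spin_weighted M s (spin_component l a s)"
  unfolding random_spin_weighted_def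
proof (intro conjI AE_I2 ballI allI)
  have "(\<lambda>p. \<Sum>m\<in>weights l. a m s (fst p) * phi l m s (snd p)) \<in> borel_measurable (M \<Otimes>\<^sub>M su2_borel)"
    using s a borel_measurable_phi[OF l]
    by (intro borel_measurable_sum borel_measurable_times measurable_compose[OF measurable_fst]
        measurable_compose[OF measurable_snd])
  then show "random_field M (spin_component l a s)"
    by (simp add: random_field_def spin_component_def split_def)
next
  fix \<omega> g t assume "g \<in> SU2"
  then show "spin_component l a s \<omega> (g ** g3 t) = spin_component l a s \<omega> g * cis (- s * t)"
    unfolding spin_component_def sum_distrib_right
    using s by (intro sum.cong refl) (simp only: phi_mult_g3[OF l] mult.assoc)
qed

text \<open>Translation by \<open>g3 t\<close> multiplies the component of weight s by cis (- s t).
  Leaving \<open>\<Theta>\<close> general covers products, products with a conjugate, and single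
  means at once.\<close>

lemma integral_spin_pair:
  fixes \<Theta> :: "complex \<Rightarrow> complex \<Rightarrow> complex"
  assumes l: "2 * l \<in> \<nat>" and X: "random_field M X" and inv: "bi_invariant M X"
    and a: "\<And>m s. m \<in> weights l \<Longrightarrow> s \<in> weights l \<Longrightarrow> a m s \<in> borel_measurable M"
    and expansion: "AE \<omega> in M. \<forall>g\<in>SU2. X \<omega> g = (\<Sum>m\<in>weights l. \<Sum>s\<in>weights l. a m s \<omega> * phi l m s g)"
    and s: "s \<in> weights l" "s' \<in> weights l"
    and \<Theta>: "case_prod \<Theta> \<in> borel_measurable (borel \<Otimes>\<^sub>M borel)"
  shows "(LINT \<omega>|M. \<Theta> (cis (- s * t) * spin_component l a s \<omega> g) (cis (- s' * t) * spin_component l a s' \<omega> g'))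
    = (LINT \<omega>|M. \<Theta> (spin_component l a s \<omega> g) (spin_component l a s' \<omega> g'))"
proof -
  let ?Y = "\<lambda>s g c. \<Sum>m\<in>weights l. c m s * phi l m s g"
  define \<Psi> where "\<Psi> c = \<Theta> (?Y s g c) (?Y s' g' c)" for c
  \<comment> \<open>The space \<open>N\<close> is arbitrary because this is used both on
    \<open>M\<close> and on the product space of the law.\<close>
  have meas: "(\<lambda>x. \<Psi> (\<lambda>m s. b m s x)) \<in> borel_measurable N"
    if "\<And>m s. m \<in> weights l \<Longrightarrow> s \<in> weights l \<Longrightarrow> b m s \<in> borel_measurable N" for b :: "real \<Rightarrow> real \<Rightarrow> 'x \<Rightarrow> complex" and N
  proof -
    have Y: "(\<lambda>x. ?Y s g (\<lambda>m s. b m s x)) \<in> borel_measurable N" if "s \<in> weights l" for s g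
      using \<open>\<And>m s. m \<in> weights l \<Longrightarrow> s \<in> weights l \<Longrightarrow> b m s \<in> borel_measurable N\<close> that
      by (intro borel_measurable_sum borel_measurable_times borel_measurable_const)
    show ?thesis
      using measurable_compose[OF measurable_Pair[OF Y[OF s(1)] Y[OF s(2)]] \<Theta>]
      by (simp add: \<Psi>_def)
  qed
  have rotated: "?Y s g (\<lambda>m k. \<Sum>s\<in>weights l. a m s \<omega> * wignerD l k s (g3 t))
      = cis (- s * t) * spin_component l a s \<omega> g" if "s \<in> weights l" for s g \<omega>
    using that unfolding spin_component_def sum_distrib_left
    by (intro sum.cong refl) (simp add: wignerD_g3[OF l] finite_weights[OF l] if_distrib[of "\<lambda>x. _ * x"] cong: if_cong)
  have "(LINT \<omega>|M. \<Psi> (\<lambda>m k. \<Sum>s\<in>weights l. a m s \<omega> * wignerD l k s (g3 t))) = (LINT \<omega>|M. \<Psi> (\<lambda>m s. a m s \<omega>))"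
  proof (rule integral_coefficients_right_mult[OF l X inv g3_SU2 _ expansion])
    fix c c' :: "real \<Rightarrow> real \<Rightarrow> complex"
    assume c: "\<And>m s. m \<in> weights l \<Longrightarrow> s \<in> weights l \<Longrightarrow> c m s = c' m s"
    have "?Y s g c = ?Y s g c'" if "s \<in> weights l" for s g
      using that by (intro sum.cong refl) (simp only: c)
    then show "\<Psi> c = \<Psi> c'" unfolding \<Psi>_def using s by (simp only:)
  next
    show "a m s \<in> borel_measurable M" if "m \<in> weights l" "s \<in> weights l" for m s
      by (rule a[OF that])
    show "(\<lambda>\<omega>. \<Psi> (\<lambda>m s. b m s \<omega>)) \<in> borel_measurable M"
      if "\<And>m s. m \<in> weights l \<Longrightarrow> s \<in> weights l \<Longrightarrow> b m s \<in> borel_measurable M" for b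
      by (rule meas[OF that])
    show "(\<lambda>F. \<Psi> (\<lambda>m s. b m s F)) \<in> borel_measurable (\<Pi>\<^sub>M g\<in>SU2. (borel :: complex measure))"
      if "\<And>m s. m \<in> weights l \<Longrightarrow> s \<in> weights l \<Longrightarrow>
        b m s \<in> borel_measurable (\<Pi>\<^sub>M g\<in>SU2. (borel :: complex measure))" for b
      by (rule meas[OF that])
  qed
  then show ?thesis by (simp only: \<Psi>_def rotated[OF s(1)] rotated[OF s(2)]) (simp only: spin_component_def)
qed

text \<open>Invariance in law under right translation by \<open>g3 t\<close> forces every first and mixed second moment
  to be multiplied by a nontrivial phase. This needs no integrability: the moments that do not
  exist have the junk value \<open>0\<close>.\<close>
lemma uncorrelated_spin_components:
  assumes l: "2 * l \<in> \<nat>" and X: "random_field M X" and inv: "bi_invariant M X"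
    and a: "\<And>m s. m \<in> weights l \<Longrightarrow> s \<in> weights l \<Longrightarrow> a m s \<in> borel_measurable M"
    and expansion: "AE \<omega> in M. \<forall>g\<in>SU2. X \<omega> g = (\<Sum>m\<in>weights l. \<Sum>s\<in>weights l. a m s \<omega> * phi l m s g)"
    and s: "s \<in> weights l" "s' \<in> weights l" and ne: "s \<noteq> s'" "s' \<noteq> - s"
  shows "uncorrelated M (spin_component l a s) (spin_component l a s')"
  unfolding uncorrelated_def
proof (intro ballI)
  fix g g' :: "complex^2^2"
  let ?Y = "\<lambda>\<omega>. spin_component l a s \<omega> g" and ?Z = "\<lambda>\<omega>. spin_component l a s' \<omega> g'"
  note pair = integral_spin_pair[OF l X inv a expansion s, of _ _ g g', symmetric]
  have YZ: "(LINT \<omega>|M. ?Y \<omega> * ?Z \<omega>) = 0"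
  proof (rule eq_0_if_cis_mult)
    fix t
    have "(LINT \<omega>|M. ?Y \<omega> * ?Z \<omega>) = (LINT \<omega>|M. (cis (- s * t) * ?Y \<omega>) * (cis (- s' * t) * ?Z \<omega>))"
      by (rule pair[of "\<lambda>x y. x * y"]) (unfold split_def, measurable)
    also have "\<dots> = (LINT \<omega>|M. cis (- (s + s') * t) * (?Y \<omega> * ?Z \<omega>))"
    proof -
      have cis: "cis (- s * t) * cis (- s' * t) = cis (- (s + s') * t)"
        by (simp add: cis_mult algebra_simps)
      show ?thesis unfolding cis[symmetric] by (simp only: mult_ac)
    qed
    finally show "(LINT \<omega>|M. ?Y \<omega> * ?Z \<omega>) = cis (- (s + s') * t) * (LINT \<omega>|M. ?Y \<omega> * ?Z \<omega>)"
      by (simp only: integral_mult_right_zero)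
  qed (use ne in simp)
  have YZ': "(LINT \<omega>|M. ?Y \<omega> * cnj (?Z \<omega>)) = 0"
  proof (rule eq_0_if_cis_mult)
    fix t
    have "(LINT \<omega>|M. ?Y \<omega> * cnj (?Z \<omega>)) = (LINT \<omega>|M. (cis (- s * t) * ?Y \<omega>) * cnj (cis (- s' * t) * ?Z \<omega>))"
      by (rule pair[of "\<lambda>x y. x * cnj y"]) (unfold split_def, measurable)
    also have "\<dots> = (LINT \<omega>|M. cis ((s' - s) * t) * (?Y \<omega> * cnj (?Z \<omega>)))"
    proof -
      have cis: "cis (- s * t) * cnj (cis (- s' * t)) = cis ((s' - s) * t)"
        by (simp add: cis_cnj cis_mult algebra_simps)
      show ?thesis unfolding cis[symmetric] complex_cnj_mult by (simp only: mult_ac)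
    qed
    finally show "(LINT \<omega>|M. ?Y \<omega> * cnj (?Z \<omega>)) = cis ((s' - s) * t) * (LINT \<omega>|M. ?Y \<omega> * cnj (?Z \<omega>))"
      by (simp only: integral_mult_right_zero)
  qed (use ne in simp)
  have Y: "(LINT \<omega>|M. ?Y \<omega>) = 0" if "s \<noteq> 0"
  proof (rule eq_0_if_cis_mult)
    fix t
    have "(LINT \<omega>|M. ?Y \<omega>) = (LINT \<omega>|M. cis (- s * t) * ?Y \<omega>)"
      by (rule pair[of "\<lambda>x y. x"]) (unfold split_def, measurable)
    then show "(LINT \<omega>|M. ?Y \<omega>) = cis (- s * t) * (LINT \<omega>|M. ?Y \<omega>)"
      by (simp only: integral_mult_right_zero)
  qed (use that in simp)
  have Z: "(LINT \<omega>|M. ?Z \<omega>) = 0" if "s' \<noteq> 0"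
  proof (rule eq_0_if_cis_mult)
    fix t
    have "(LINT \<omega>|M. ?Z \<omega>) = (LINT \<omega>|M. cis (- s' * t) * ?Z \<omega>)"
      by (rule pair[of "\<lambda>x y. y"]) (unfold split_def, measurable)
    then show "(LINT \<omega>|M. ?Z \<omega>) = cis (- s' * t) * (LINT \<omega>|M. ?Z \<omega>)"
      by (simp only: integral_mult_right_zero)
  qed (use that in simp)
  \<comment> \<open>At most one of two different weights is 0, so at least one mean vanishes, as
    both mixed moments do.\<close>
  have "(LINT \<omega>|M. ?Y \<omega>) = 0 \<or> (LINT \<omega>|M. ?Z \<omega>) = 0" using Y Z ne by metis
  with YZ YZ' show "(LINT \<omega>|M. ?Y \<omega> * ?Z \<omega>) = (LINT \<omega>|M. ?Y \<omega>) * (LINT \<omega>|M. ?Z \<omega>) \<and>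
      (LINT \<omega>|M. ?Y \<omega> * cnj (?Z \<omega>)) = (LINT \<omega>|M. ?Y \<omega>) * cnj (LINT \<omega>|M. ?Z \<omega>)"
    by auto
qed

section \<open>Expected share of mass in each spin weight\<close>

lemma borel_measurable_L2_norm_random_field:
  assumes "random_field M X"
  shows "(\<lambda>\<omega>. L2_norm_SU2 (X \<omega>)) \<in> borel_measurable M"
proof -
  interpret finite_measure su2_volume by (rule finite_measure_su2_volume)
  have "sets (M \<Otimes>\<^sub>M su2_borel) = sets (M \<Otimes>\<^sub>M su2_volume)"
    by (rule sets_pair_measure_cong[OF refl sets_su2_volume[symmetric]])
  then have sets_eq: "borel_measurable (M \<Otimes>\<^sub>M su2_borel)
      = (borel_measurable (M \<Otimes>\<^sub>M su2_volume) :: (_ \<Rightarrow> complex) set)"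
    by (rule measurable_cong_sets[OF _ refl])
  have "(\<lambda>p. X (fst p) (snd p)) \<in> borel_measurable (M \<Otimes>\<^sub>M su2_volume)"
    using assms unfolding random_field_def sets_eq split_def .
  then have "(\<lambda>p. (cmod (X (fst p) (snd p)))\<^sup>2) \<in> borel_measurable (M \<Otimes>\<^sub>M su2_volume)"
    by (intro borel_measurable_power measurable_compose[OF _ borel_measurable_norm])
  then have "(\<lambda>\<omega>. LINT g|su2_volume. (cmod (X \<omega> g))\<^sup>2) \<in> borel_measurable M"
    by (intro borel_measurable_lebesgue_integral) (simp only: split_def)
  then show ?thesis
    unfolding L2_norm_SU2_def by (rule measurable_compose[OF _ borel_measurable_sqrt])
qed

text \<open>The squared norm of a component relative to that of the field, in coefficients; the
  common factor of the two norms has cancelled. For a zero denominator the value is 0, so the ratio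
  lies between 0 and 1 for every \<open>c\<close>.\<close>

definition mass_ratio :: "real \<Rightarrow> real \<Rightarrow> (real \<Rightarrow> real \<Rightarrow> complex) \<Rightarrow> real" where
  "mass_ratio l s c = (\<Sum>m\<in>weights l. wigner_mass l m * (cmod (c m s))\<^sup>2)
    / (\<Sum>m\<in>weights l. \<Sum>s\<in>weights l. wigner_mass l m * (cmod (c m s))\<^sup>2)"

context
  fixes l :: real
  assumes l: "2 * l \<in> \<nat>"
begin

lemma mass_ratio_nonneg: "0 \<le> mass_ratio l s c"
  unfolding mass_ratio_def by (intro divide_nonneg_nonneg sum_nonneg mult_nonneg_nonneg wigner_mass_nonneg) simp_all

lemma sum_mass_ratio:
  assumes "(\<Sum>m\<in>weights l. \<Sum>s\<in>weights l. wigner_mass l m * (cmod (c m s))\<^sup>2) \<noteq> 0"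
  shows "(\<Sum>s\<in>weights l. mass_ratio l s c) = 1"
proof -
  have "(\<Sum>s\<in>weights l. mass_ratio l s c)
      = (\<Sum>s\<in>weights l. \<Sum>m\<in>weights l. wigner_mass l m * (cmod (c m s))\<^sup>2)
        / (\<Sum>m\<in>weights l. \<Sum>s\<in>weights l. wigner_mass l m * (cmod (c m s))\<^sup>2)"
    unfolding mass_ratio_def by (rule sum_divide_distrib[symmetric])
  then show ?thesis using assms by (subst (asm) sum.swap) simp
qed

lemma mass_ratio_le_1:
  assumes "s \<in> weights l"
  shows "mass_ratio l s c \<le> 1"
proof (cases "(\<Sum>m\<in>weights l. \<Sum>s\<in>weights l. wigner_mass l m * (cmod (c m s))\<^sup>2) = 0")
  case True
  then show ?thesis by (simp add: mass_ratio_def)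
next
  case False
  have "mass_ratio l s c \<le> (\<Sum>s\<in>weights l. mass_ratio l s c)"
    by (intro member_le_sum assms mass_ratio_nonneg finite_weights l)
  then show ?thesis by (simp only: sum_mass_ratio[OF False])
qed

lemma borel_measurable_mass_ratio:
  assumes "\<And>m s. m \<in> weights l \<Longrightarrow> s \<in> weights l \<Longrightarrow> b m s \<in> borel_measurable N" "s \<in> weights l"
  shows "(\<lambda>x. mass_ratio l s (\<lambda>m s. b m s x)) \<in> borel_measurable N"
  unfolding mass_ratio_def using assms
  by (intro borel_measurable_divide borel_measurable_sum borel_measurable_times borel_measurable_const
      borel_measurable_power measurable_compose[OF _ borel_measurable_norm])

lemma mass_ratio_cong:
  assumes "\<And>m s. m \<in> weights l \<Longrightarrow> s \<in> weights l \<Longrightarrow> c m s = c' m s" "s \<in> weights l"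
  shows "mass_ratio l s c = mass_ratio l s c'"
  unfolding mass_ratio_def using assms
  by (intro arg_cong2[of _ _ _ _ "(/)"] sum.cong refl) (simp_all only:)

text \<open>The right translates by \<open>h ** g3 (node l j)\<close> have the same total mass, and by Parseval their
  masses in spin weight \<open>k\<close> average out the interference between different spin weights.\<close>
lemma sum_mass_ratio_rotations:
  assumes k: "k \<in> weights l" and h: "h \<in> SU2"
  shows "(\<Sum>j<card (weights l). mass_ratio l k
      (\<lambda>m k. \<Sum>s\<in>weights l. c m s * wignerD l k s (h ** g3 (node l j))))
    = real (card (weights l)) * (\<Sum>s\<in>weights l. (cmod (wignerD l k s h))\<^sup>2 * mass_ratio l s c)"
proof -
  let ?N = "card (weights l)"
  define w where "w m = wigner_mass l m" for m
  define R where "R = (\<Sum>m\<in>weights l. \<Sum>s\<in>weights l. w m * (cmod (c m s))\<^sup>2)"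
  \<comment> \<open>The weight \<open>w m\<close> is constant along row m, so the isometry applies
    row by row.\<close>
  have total: "(\<Sum>m\<in>weights l. \<Sum>k\<in>weights l. w m *
      (cmod (\<Sum>s\<in>weights l. c m s * wignerD l k s (h ** g3 t)))\<^sup>2) = R" for t
    unfolding R_def sum_distrib_left[symmetric]
    by (intro sum.cong refl arg_cong2[of _ _ _ _ "(*)"] wignerD_isometry l) (simp add: h)
  have phase: "(\<Sum>s\<in>weights l. c m s * wignerD l k s (h ** g3 t))
      = (\<Sum>s\<in>weights l. (c m s * wignerD l k s h) * cis (- s * t))" for m t
    using k h by (intro sum.cong refl) (simp only: wignerD_mult_g3[OF l] mult.assoc)
  have "(\<Sum>j<?N. mass_ratio l k (\<lambda>m k. \<Sum>s\<in>weights l. c m s * wignerD l k s (h ** g3 (node l j))))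
      = (\<Sum>j<?N. (\<Sum>m\<in>weights l. w m *
          (cmod (\<Sum>s\<in>weights l. (c m s * wignerD l k s h) * cis (- s * node l j)))\<^sup>2) / R)"
    unfolding mass_ratio_def w_def[symmetric] total phase ..
  also have "\<dots> = (\<Sum>m\<in>weights l. w m * (\<Sum>j<?N.
          (cmod (\<Sum>s\<in>weights l. (c m s * wignerD l k s h) * cis (- s * node l j)))\<^sup>2)) / R"
    unfolding sum_divide_distrib[symmetric] sum_distrib_left by (subst sum.swap) (rule refl)
  also have "\<dots> = (\<Sum>m\<in>weights l. w m * (real ?N * (\<Sum>s\<in>weights l. (cmod (c m s * wignerD l k s h))\<^sup>2))) / R"
    by (simp only: dft_parseval[OF l])
  also have "(\<Sum>m\<in>weights l. w m * (real ?N * (\<Sum>s\<in>weights l. (cmod (c m s * wignerD l k s h))\<^sup>2)))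
      = (\<Sum>m\<in>weights l. \<Sum>s\<in>weights l. real ?N * ((cmod (wignerD l k s h))\<^sup>2 * (w m * (cmod (c m s))\<^sup>2)))"
    by (simp only: sum_distrib_left norm_mult power_mult_distrib mult_ac)
  also have "\<dots> = real ?N * (\<Sum>s\<in>weights l. (cmod (wignerD l k s h))\<^sup>2 * (\<Sum>m\<in>weights l. w m * (cmod (c m s))\<^sup>2))"
    by (subst sum.swap) (simp only: sum_distrib_left)
  also have "\<dots> / R = real ?N * (\<Sum>s\<in>weights l. (cmod (wignerD l k s h))\<^sup>2 * mass_ratio l s c)"
    by (simp only: mass_ratio_def R_def w_def times_divide_eq_right flip: sum_divide_distrib)
  finally show ?thesis .
qed

lemma integral_mass_ratio:
  assumes M: "prob_space M" and X: "random_field M X" and inv: "bi_invariant M X"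
    and a: "\<And>m s. m \<in> weights l \<Longrightarrow> s \<in> weights l \<Longrightarrow> a m s \<in> borel_measurable M"
    and expansion: "AE \<omega> in M. \<forall>g\<in>SU2. X \<omega> g = (\<Sum>m\<in>weights l. \<Sum>s\<in>weights l. a m s \<omega> * phi l m s g)"
    and nonzero: "AE \<omega> in M. (\<Sum>m\<in>weights l. \<Sum>s\<in>weights l. wigner_mass l m * (cmod (a m s \<omega>))\<^sup>2) \<noteq> 0"
    and s: "s \<in> weights l"
  shows "(LINT \<omega>|M. mass_ratio l s (\<lambda>m s. a m s \<omega>)) = 1 / real (card (weights l))"
proof -
  interpret prob_space M by (rule M)
  let ?N = "card (weights l)" and ?h = generic_rotation
  define T where "T s = (LINT \<omega>|M. mass_ratio l s (\<lambda>m s. a m s \<omega>))" for s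
  have N: "?N \<noteq> 0" by (simp add: card_weights[OF l])
  have int: "integrable M (\<lambda>\<omega>. mass_ratio l s (\<lambda>m s. b m s \<omega>))"
    if "\<And>m s. m \<in> weights l \<Longrightarrow> s \<in> weights l \<Longrightarrow> b m s \<in> borel_measurable M" "s \<in> weights l" for b s
    using that mass_ratio_nonneg mass_ratio_le_1[OF that(2)]
    by (intro integrable_const_bound[of _ 1] borel_measurable_mass_ratio AE_I2) simp_all
  have T_fixed: "T k = (\<Sum>s\<in>weights l. (cmod (wignerD l k s ?h))\<^sup>2 * T s)" if k: "k \<in> weights l" for k
  proof -
    have hj: "?h ** g3 (node l j) \<in> SU2" for j by (simp add: generic_rotation_SU2)
    let ?b = "\<lambda>j m k \<omega>. \<Sum>s\<in>weights l. a m s \<omega> * wignerD l k s (?h ** g3 (node l j))"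
    have "real ?N * T k = (\<Sum>j<?N. T k)" by (simp only: sum_constant card_lessThan)
    also have "\<dots> = (\<Sum>j<?N. LINT \<omega>|M. mass_ratio l k (\<lambda>m k. ?b j m k \<omega>))"
      unfolding T_def
    proof (rule sum.cong[OF refl], rule sym)
      fix j
      show "(LINT \<omega>|M. mass_ratio l k (\<lambda>m k. ?b j m k \<omega>)) = (LINT \<omega>|M. mass_ratio l k (\<lambda>m s. a m s \<omega>))"
      proof (rule integral_coefficients_right_mult[OF l X inv hj _ expansion])
        show "a m s \<in> borel_measurable M" if "m \<in> weights l" "s \<in> weights l" for m s
          by (rule a[OF that])
        show "mass_ratio l k c = mass_ratio l k c'"
          if "\<And>m s. m \<in> weights l \<Longrightarrow> s \<in> weights l \<Longrightarrow> c m s = c' m s" for c c'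
          by (rule mass_ratio_cong[OF that k])
        show "(\<lambda>\<omega>. mass_ratio l k (\<lambda>m s. b m s \<omega>)) \<in> borel_measurable M"
          if "\<And>m s. m \<in> weights l \<Longrightarrow> s \<in> weights l \<Longrightarrow> b m s \<in> borel_measurable M" for b
          by (rule borel_measurable_mass_ratio[OF that k])
        show "(\<lambda>F. mass_ratio l k (\<lambda>m s. b m s F)) \<in> borel_measurable (\<Pi>\<^sub>M g\<in>SU2. (borel :: complex measure))"
          if "\<And>m s. m \<in> weights l \<Longrightarrow> s \<in> weights l \<Longrightarrow>
            b m s \<in> borel_measurable (\<Pi>\<^sub>M g\<in>SU2. (borel :: complex measure))" for b
          by (rule borel_measurable_mass_ratio[OF that k])
      qed
    qed
    also have "\<dots> = (LINT \<omega>|M. (\<Sum>j<?N. mass_ratio l k (\<lambda>m k. ?b j m k \<omega>)))"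
      by (intro Bochner_Integration.integral_sum[symmetric] int k
          borel_measurable_sum borel_measurable_times borel_measurable_const a)
    also have "\<dots> = (LINT \<omega>|M. real ?N * (\<Sum>s\<in>weights l. (cmod (wignerD l k s ?h))\<^sup>2 * mass_ratio l s (\<lambda>m s. a m s \<omega>)))"
      by (simp only: sum_mass_ratio_rotations[OF k generic_rotation_SU2])
    also have "\<dots> = real ?N * (LINT \<omega>|M. (\<Sum>s\<in>weights l. (cmod (wignerD l k s ?h))\<^sup>2 * mass_ratio l s (\<lambda>m s. a m s \<omega>)))"
      by (rule integral_mult_right_zero)
    also have "(LINT \<omega>|M. (\<Sum>s\<in>weights l. (cmod (wignerD l k s ?h))\<^sup>2 * mass_ratio l s (\<lambda>m s. a m s \<omega>)))
        = (\<Sum>s\<in>weights l. LINT \<omega>|M. (cmod (wignerD l k s ?h))\<^sup>2 * mass_ratio l s (\<lambda>m s. a m s \<omega>))"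
      by (intro Bochner_Integration.integral_sum integrable_mult_right int a)
    also have "\<dots> = (\<Sum>s\<in>weights l. (cmod (wignerD l k s ?h))\<^sup>2 * T s)"
      unfolding T_def by (intro sum.cong refl integral_mult_right_zero)
    finally show ?thesis using N by simp
  qed
  have T_const: "T k = T l" if "k \<in> weights l" for k
  proof (rule constant_if_stochastic_fixed_point[of "weights l" "\<lambda>k s. (cmod (wignerD l k s ?h))\<^sup>2" l T k])
    show "(\<Sum>s\<in>weights l. (cmod (wignerD l k s ?h))\<^sup>2) = 1" if "k \<in> weights l" for k
      by (rule sum_norm_wignerD_row[OF l that generic_rotation_SU2])
    show "0 < (cmod (wignerD l k l ?h))\<^sup>2" if "k \<in> weights l" for k
      using wignerD_generic_rotation_nonzero[OF l that] by simp
  qed (simp_all only: that T_fixed finite_weights[OF l] top_weight[OF l], simp)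
  \<comment> \<open>The constant is fixed by normalisation: the ratios of a nonzero field sum to
    1.\<close>
  have "real ?N * T l = (\<Sum>k\<in>weights l. T k)" by (simp only: T_const sum_constant cong: sum.cong)
  also have "\<dots> = (LINT \<omega>|M. (\<Sum>k\<in>weights l. mass_ratio l k (\<lambda>m s. a m s \<omega>)))"
    unfolding T_def by (intro Bochner_Integration.integral_sum[symmetric] int a)
  also have "\<dots> = (LINT \<omega>|M. 1)"
  proof (rule integral_cong_AE)
    show "AE \<omega> in M. (\<Sum>k\<in>weights l. mass_ratio l k (\<lambda>m s. a m s \<omega>)) = 1"
      using nonzero by eventually_elim (rule sum_mass_ratio)
  qed (intro borel_measurable_sum borel_measurable_mass_ratio a, assumption+, rule borel_measurable_const)
  also have "\<dots> = 1" by (simp add: prob_space)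
  finally have "T l = 1 / real ?N" using N by (simp add: field_simps)
  then show ?thesis using T_const[OF s] by (simp add: T_def)
qed

lemma expected_RS_uniform:
  assumes M: "prob_space M" and X: "random_field M X" and inv: "bi_invariant M X"
    and a: "\<And>m s. m \<in> weights l \<Longrightarrow> s \<in> weights l \<Longrightarrow> a m s \<in> borel_measurable M"
    and expansion: "AE \<omega> in M. \<forall>g\<in>SU2. X \<omega> g = (\<Sum>m\<in>weights l. \<Sum>s\<in>weights l. a m s \<omega> * phi l m s g)"
    and nonzero: "AE \<omega> in M. L2_norm_SU2 (X \<omega>) \<noteq> 0"
  shows "expected_RS M l a X = uniform_count_measure (weights l)"
proof -
  define K where "K = (2 * l + 1) / (4 * pi)\<^sup>2"
  have K: "K \<noteq> 0" using weights_nonneg[OF l] by (simp add: K_def)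
  have norm_X: "AE \<omega> in M. (L2_norm_SU2 (X \<omega>))\<^sup>2
      = K * (\<Sum>m\<in>weights l. \<Sum>s\<in>weights l. wigner_mass l m * (cmod (a m s \<omega>))\<^sup>2)"
    using expansion
  proof eventually_elim
    case (elim \<omega>)
    then have "L2_norm_SU2 (X \<omega>) = L2_norm_SU2 (\<lambda>g. \<Sum>m\<in>weights l. \<Sum>s\<in>weights l. a m s \<omega> * phi l m s g)"
      by (intro L2_norm_SU2_cong) blast
    then show ?case by (simp only: L2_norm_phi_expansion[OF l] K_def)
  qed
  \<comment> \<open>Almost surely the denominator of the mass ratios is nonzero, which their
    normalisation to total 1 relies on.\<close>
  have mass: "AE \<omega> in M. (\<Sum>m\<in>weights l. \<Sum>s\<in>weights l. wigner_mass l m * (cmod (a m s \<omega>))\<^sup>2) \<noteq> 0"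
    using nonzero norm_X by eventually_elim auto
  have density: "(LINT \<omega>|M. (L2_norm_SU2 (spin_component l a s \<omega>))\<^sup>2 / (L2_norm_SU2 (X \<omega>))\<^sup>2)
      = 1 / real (card (weights l))" if s: "s \<in> weights l" for s
  proof -
    have "(LINT \<omega>|M. (L2_norm_SU2 (spin_component l a s \<omega>))\<^sup>2 / (L2_norm_SU2 (X \<omega>))\<^sup>2)
        = (LINT \<omega>|M. mass_ratio l s (\<lambda>m s. a m s \<omega>))"
    proof (rule integral_cong_AE)
      have "random_spin_weighted M s (spin_component l a s)"
        by (intro random_spin_weighted_spin_component l s a)
      then have "random_field M (spin_component l a s)" by (simp add: random_spin_weighted_def)
      then show "(\<lambda>\<omega>. (L2_norm_SU2 (spin_component l a s \<omega>))\<^sup>2 / (L2_norm_SU2 (X \<omega>))\<^sup>2) \<in> borel_measurable M"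
        using X by (intro borel_measurable_divide borel_measurable_power borel_measurable_L2_norm_random_field)
      show "(\<lambda>\<omega>. mass_ratio l s (\<lambda>m s. a m s \<omega>)) \<in> borel_measurable M"
        by (intro borel_measurable_mass_ratio a s)
      show "AE \<omega> in M. (L2_norm_SU2 (spin_component l a s \<omega>))\<^sup>2 / (L2_norm_SU2 (X \<omega>))\<^sup>2
          = mass_ratio l s (\<lambda>m s. a m s \<omega>)"
        using norm_X
      proof eventually_elim
        case (elim \<omega>)
        show ?case
          unfolding elim L2_norm_spin_component[OF l s] mass_ratio_def K_def[symmetric]
          using K by (rule mult_divide_mult_cancel_left)
      qed
    qed
    then show ?thesis by (simp only: integral_mass_ratio[OF M X inv a expansion mass s])
  qed
  show ?thesis
    unfolding expected_RS_def uniform_count_measure_def point_measure_def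
    by (rule density_cong) (simp_all add: AE_count_space density)
qed

end

text \<open>The premise of the last conjunct excludes vanishing fields: there each ratio is 0 / 0 =
  0, and the expected masses would add up to less than 1.\<close>

theorem theorem5:
  fixes M :: "'w measure"
    and l :: real
    and a :: "real \<Rightarrow> real \<Rightarrow> 'w \<Rightarrow> complex"
    and X :: "'w \<Rightarrow> complex^2^2 \<Rightarrow> complex"
  assumes "prob_space M"
    and "2 * l \<in> \<nat>"
    and "random_field M X"
    and "square_integrable_field M X"
    and "bi_invariant M X"
    and "\<And>m s. m \<in> weights l \<Longrightarrow> s \<in> weights l \<Longrightarrow> a m s \<in> borel_measurable M"
    and "AE \<omega> in M. \<forall>g\<in>SU2. X \<omega> g = (\<Sum>m\<in>weights l. \<Sum>s\<in>weights l. a m s \<omega> * phi l m s g)"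
  shows "(AE \<omega> in M. \<forall>g\<in>SU2. X \<omega> g = (\<Sum>s\<in>weights l. spin_component l a s \<omega> g))
    \<and> (\<forall>s\<in>weights l. random_spin_weighted M s (spin_component l a s))
    \<and> (\<forall>s\<in>weights l. \<forall>s'\<in>weights l. s \<noteq> s' \<longrightarrow>
          correlated M (spin_component l a s) (spin_component l a s') \<longrightarrow> s' = - s)
    \<and> ((AE \<omega> in M. L2_norm_SU2 (X \<omega>) \<noteq> 0) \<longrightarrow>
          expected_RS M l a X = uniform_count_measure (weights l))"
proof (intro conjI ballI impI)
  have swap: "(\<Sum>m\<in>weights l. \<Sum>s\<in>weights l. a m s \<omega> * phi l m s g)
      = (\<Sum>s\<in>weights l. spin_component l a s \<omega> g)" for \<omega> g
    unfolding spin_component_def by (rule sum.swap)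
  show "AE \<omega> in M. \<forall>g\<in>SU2. X \<omega> g = (\<Sum>s\<in>weights l. spin_component l a s \<omega> g)"
    using assms(7) unfolding swap .
  show "random_spin_weighted M s (spin_component l a s)" if "s \<in> weights l" for s
    using that by (intro random_spin_weighted_spin_component assms(2,6))
  show "s' = - s" if "s \<in> weights l" "s' \<in> weights l" "s \<noteq> s'"
    "correlated M (spin_component l a s) (spin_component l a s')" for s s'
    using uncorrelated_spin_components[OF assms(2,3,5,6,7) that(1-3)] that(4) by blast
  show "expected_RS M l a X = uniform_count_measure (weights l)" if "AE \<omega> in M. L2_norm_SU2 (X \<omega>) \<noteq> 0"
    by (rule expected_RS_uniform[OF assms(2,1,3,5,6,7) that])
qed

end
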